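(* Let $\Gamma_1$ be a uniformly bounded connected weighted graph which covers a weighted graph $\Gamma_2$, and suppose that either (a) $\Gamma_1$ is amenable and $\Gamma_2$ is finite, or (b) $\Gamma_1$ has subexponential growth. Let $H_1,H_2$ be the Laplace type operators on $l^2(\Gamma_1),l^2(\Gamma_2)$ associated to the weighted graphs $\Gamma_1,\Gamma_2$. Then $\sigma(H_2)\subset\sigma(H_1)$, where $\sigma(\cdot)$ denotes the spectrum of a bounded operator.
   Context: Graphs $\Gamma=(V,E)$ are non-directed, of uniformly bounded degree, and may have loops and multiple edges. For a vertex $v$, $E_v$ is the set of edges adjacent to $v$; a loop at $v$ contributes one element to $E_v$ and contributes $1$ to the degree. For $e\in E_v$, $r_v(e)$ is the other endpoint of $e$ ($r_v(e)=v$ if $e$ is a loop). $l^2(\Gamma)$ denotes $l^2(V)$ (complex-valued). Weighted graphs. A weighted graph is a graph together with a weight $\alpha_{v,e}\in\mathbb C$ for every pair of a vertex $v$ and an edge $e\in E_v$. It is uniformly bounded if it has uniformly bounded degree and the set of weights is bounded. The associated Laplace type operator on $l^2(\Gamma)$ is the bounded operator $(H_\alpha f)(v)=\sum_{e\in E_v}\alpha_{v,e}f(r_v(e))$ (not assumed self-adjoint). Coverings. A graph $\widetilde\Gamma=(\widetilde V,\widetilde E)$ covers $\Gamma=(V,E)$ if there are surjective maps $\widetilde V\to V$ and $\widetilde E\to E$, both denoted $\phi$, forming a local isomorphism: for each $\tilde v\in\widetilde V$, $\phi$ maps $\widetilde E_{\tilde v}$ bijectively onto $E_{\phi(\tilde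 v)}$, and $\phi(r_{\tilde v}(\tilde e))=r_{\phi(\tilde v)}(\phi(\tilde e))$ for $\tilde e\in\widetilde E_{\tilde v}$. A weighted graph $\widetilde\Gamma$ with weights $\tilde\alpha$ covers a weighted graph $\Gamma$ with weights $\alpha$ if there is such a $\phi$ with $\tilde\alpha_{\tilde v,\tilde e}=\alpha_{\phi(\tilde v),\phi(\tilde e)}$ for every edge $\tilde e$ of $\widetilde\Gamma$ and every vertex $\tilde v$ of $\tilde e$. Growth and amenability. $B_n(v)$ is the ball of radius $n$ around the vertex $v$ (in the path metric), and $B_n(A)=\bigcup_{v\in A}B_n(v)$ for a set $A$ of vertices. $\Gamma$ has subexponential growth if $\liminf_{n\to\infty}|B_n(v)|^{1/n}=1$ for some vertex $v$ (equivalently, for connected $\Gamma$, for all $v$). $\Gamma$ is amenable if there is an increasing sequence $(F_k)_{k\in\mathbb N}$ of finite sets of vertices with $\bigcup_kF_k=V$ and $\lim_{k\to\infty}|B_1(F_k)\setminus F_k|/|F_k|=0$. *)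

theory Defs
  imports "HOL-Analysis.Analysis" "HOL-Library.Extended_Nat"
begin

text \<open>An edge carries its set of endpoints, which is a singleton for a loop; different
  edges may have the same endpoints.\<close>

record ('v, 'e) mgraph =
  verts :: "'v set"
  edges :: "'e set"
  ends :: "'e \<Rightarrow> 'v set"

definition edges_at :: "('v, 'e, 'z) mgraph_scheme \<Rightarrow> 'v \<Rightarrow> 'e set" where
  "edges_at G v = {e \<in> edges G. v \<in> ends G e}"

definition other_end :: "('v, 'e, 'z) mgraph_scheme \<Rightarrow> 'v \<Rightarrow> 'e \<Rightarrow> 'v" where
  "other_end G v e = (THE w. ends G e = {v, w})"

text \<open>A loop is a single element of \<open>edges_at\<close>, so it contributes 1 to the degree.\<close>

definition bounded_degree :: "('v, 'e, 'z) mgraph_scheme \<Rightarrow> bool" where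
  "bounded_degree G \<longleftrightarrow>
     (\<exists>D. \<forall>v \<in> verts G. finite (edges_at G v) \<and> card (edges_at G v) \<le> D)"

definition is_mgraph :: "('v, 'e, 'z) mgraph_scheme \<Rightarrow> bool" where
  "is_mgraph G \<longleftrightarrow>
     (\<forall>e \<in> edges G. \<exists>u \<in> verts G. \<exists>w \<in> verts G. ends G e = {u, w}) \<and> bounded_degree G"

definition finite_mgraph :: "('v, 'e, 'z) mgraph_scheme \<Rightarrow> bool" where
  "finite_mgraph G \<longleftrightarrow> finite (verts G) \<and> finite (edges G)"

definition adj :: "('v, 'e, 'z) mgraph_scheme \<Rightarrow> ('v \<times> 'v) set" where
  "adj G = {(u, w). \<exists>e \<in> edges G. ends G e = {u, w}}"

text \<open>The value is infinite if there is no path from u to v.\<close>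

definition path_dist :: "('v, 'e, 'z) mgraph_scheme \<Rightarrow> 'v \<Rightarrow> 'v \<Rightarrow> enat" where
  "path_dist G u v = (INF n \<in> {n. (u, v) \<in> adj G ^^ n}. enat n)"

definition connected_mgraph :: "('v, 'e, 'z) mgraph_scheme \<Rightarrow> bool" where
  "connected_mgraph G \<longleftrightarrow> (\<forall>u \<in> verts G. \<forall>v \<in> verts G. (u, v) \<in> (adj G)\<^sup>*)"

definition vball :: "('v, 'e, 'z) mgraph_scheme \<Rightarrow> nat \<Rightarrow> 'v \<Rightarrow> 'v set" where
  "vball G n v = {w \<in> verts G. path_dist G v w \<le> enat n}"

definition vball_set :: "('v, 'e, 'z) mgraph_scheme \<Rightarrow> nat \<Rightarrow> 'v set \<Rightarrow> 'v set" where
  "vball_set G n A = (\<Union>v \<in> A. vball G n v)"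

definition subexponential_growth :: "('v, 'e, 'z) mgraph_scheme \<Rightarrow> bool" where
  "subexponential_growth G \<longleftrightarrow>
     (\<exists>v \<in> verts G. liminf (\<lambda>n. ereal (root n (real (card (vball G n v))))) = 1)"

definition amenable :: "('v, 'e, 'z) mgraph_scheme \<Rightarrow> bool" where
  "amenable G \<longleftrightarrow>
     (\<exists>F :: nat \<Rightarrow> 'v set. incseq F \<and> (\<forall>k. finite (F k)) \<and> (\<Union>k. F k) = verts G \<and>
        (\<lambda>k. real (card (vball_set G 1 (F k) - F k)) / real (card (F k))) \<longlonglongrightarrow> 0)"

text \<open>Only the values \<open>weight G v e\<close> with e adjacent to v are relevant.\<close>

record ('v, 'e) wgraph = "('v, 'e) mgraph" +
  weight :: "'v \<Rightarrow> 'e \<Rightarrow> complex"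

definition uniformly_bounded :: "('v, 'e, 'z) wgraph_scheme \<Rightarrow> bool" where
  "uniformly_bounded G \<longleftrightarrow> bounded_degree G \<and>
     bounded {weight G v e | v e. v \<in> verts G \<and> e \<in> edges_at G v}"

definition covering ::
  "('v1, 'e1, 'z1) mgraph_scheme \<Rightarrow> ('v2, 'e2, 'z2) mgraph_scheme \<Rightarrow>
     ('v1 \<Rightarrow> 'v2) \<Rightarrow> ('e1 \<Rightarrow> 'e2) \<Rightarrow> bool" where
  "covering G1 G2 p q \<longleftrightarrow>
     p ` verts G1 = verts G2 \<and> q ` edges G1 = edges G2 \<and>
     (\<forall>v \<in> verts G1. bij_betw q (edges_at G1 v) (edges_at G2 (p v)) \<and>
        (\<forall>e \<in> edges_at G1 v. p (other_end G1 v e) = other_end G2 (p v) (q e)))"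

definition weighted_covers ::
  "('v1, 'e1, 'z1) wgraph_scheme \<Rightarrow> ('v2, 'e2, 'z2) wgraph_scheme \<Rightarrow> bool" where
  "weighted_covers G1 G2 \<longleftrightarrow>
     (\<exists>p q. covering G1 G2 p q \<and>
        (\<forall>v \<in> verts G1. \<forall>e \<in> edges_at G1 v. weight G1 v e = weight G2 (p v) (q e)))"

text \<open>Square-summable functions on V are represented by their extensions by zero to the
  whole type, so that equality in the space is equality of functions.\<close>

definition l2 :: "'v set \<Rightarrow> ('v \<Rightarrow> complex) set" where
  "l2 V = {f. (\<forall>v. v \<notin> V \<longrightarrow> f v = 0) \<and> (\<lambda>v. (cmod (f v))\<^sup>2) summable_on V}"

definition l2_norm :: "'v set \<Rightarrow> ('v \<Rightarrow> complex) \<Rightarrow> real" where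
  "l2_norm V f = sqrt (\<Sum>\<^sub>\<infinity>v \<in> V. (cmod (f v))\<^sup>2)"

definition l2_bounded_operator :: "'v set \<Rightarrow> (('v \<Rightarrow> complex) \<Rightarrow> ('v \<Rightarrow> complex)) \<Rightarrow> bool" where
  "l2_bounded_operator V T \<longleftrightarrow>
     (\<forall>f \<in> l2 V. T f \<in> l2 V) \<and>
     (\<forall>f \<in> l2 V. \<forall>g \<in> l2 V. T (\<lambda>v. f v + g v) = (\<lambda>v. T f v + T g v)) \<and>
     (\<forall>c. \<forall>f \<in> l2 V. T (\<lambda>v. c * f v) = (\<lambda>v. c * T f v)) \<and>
     (\<exists>C. \<forall>f \<in> l2 V. l2_norm V (T f) \<le> C * l2_norm V f)"

definition l2_invertible :: "'v set \<Rightarrow> (('v \<Rightarrow> complex) \<Rightarrow> ('v \<Rightarrow> complex)) \<Rightarrow> bool" where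
  "l2_invertible V T \<longleftrightarrow>
     (\<exists>S. l2_bounded_operator V S \<and> (\<forall>f \<in> l2 V. S (T f) = f \<and> T (S f) = f))"

text \<open>To be applied to operators T that are bounded on the space in question.\<close>

definition l2_spectrum :: "'v set \<Rightarrow> (('v \<Rightarrow> complex) \<Rightarrow> ('v \<Rightarrow> complex)) \<Rightarrow> complex set" where
  "l2_spectrum V T = {c. \<not> l2_invertible V (\<lambda>f v. T f v - c * f v)}"

definition laplace :: "('v, 'e, 'z) wgraph_scheme \<Rightarrow> ('v \<Rightarrow> complex) \<Rightarrow> 'v \<Rightarrow> complex" where
  "laplace G f = (\<lambda>v. if v \<in> verts G
     then \<Sum>e \<in> edges_at G v. weight G v e * f (other_end G v e) else 0)"

end

theory Submission
  imports Defs
begin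

text \<open>Fix a complex number \<open>c\<close>, put \<open>T1 = H1 - c\<close> and \<open>T2 = H2 - c\<close>, and suppose that \<open>T1\<close> is invertible.
The claim is that \<open>T2\<close> is invertible. The operators need not be self-adjoint or even normal, so it is
not enough to look at approximate eigenvectors of \<open>T2\<close>: one has to bound both \<open>T2\<close> and its adjoint
from below. The adjoints are again Laplace type operators, with the weights
\<open>adjoint_weight\<close>, and the covering respects these weights as well. Hence everything rests on one
statement (\<open>bounded_below_covering\<close>): a lower bound \<open>\<parallel>h\<parallel> \<le> C \<parallel>T1 h\<parallel>\<close> for finitely supported \<open>h\<close> passes to
\<open>T2\<close> with the same constant.

To transfer the bound, a finitely supported \<open>f\<close> on the vertices of \<open>\<Gamma>2\<close> is lifted to \<open>\<Gamma>1\<close>. The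
pull-back \<open>f \<circ> p\<close> need not be square-summable, so it is multiplied by a finitely supported cut-off \<open>\<omega>\<close>, and the
result is normalized separately on every fibre of \<open>p\<close>:
\<open>h y = \<omega> y / N (p y) * f (p y)\<close>, where \<open>N b\<close> is the \<open>l\<^sup>2\<close> norm of \<open>\<omega>\<close> on the fibre over \<open>b\<close>. Then
\<open>\<parallel>h\<parallel> = \<parallel>f\<parallel>\<close>, irrespective of how unevenly \<open>\<omega>\<close> is spread over the fibres. An edge \<open>e\<close> of \<open>\<Gamma>2\<close>
from \<open>b\<close> to \<open>b'\<close> lifts to a bijection of the fibre over \<open>b\<close> onto the fibre over \<open>b'\<close>
(\<open>transport e\<close>). If \<open>\<omega>\<close> changes under every such bijection by at most \<open>\<eta> N\<close> in \<open>l\<^sup>2\<close> norm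
(\<open>almost_invariant\<close>), then \<open>T1 h\<close> differs from the lift of \<open>T2 f\<close> by \<open>O(\<eta>) \<parallel>f\<parallel>\<close>
(\<open>laplace_matrix_lift\<close>), and \<open>\<eta> \<rightarrow> 0\<close> gives the bound for \<open>T2\<close>.

The two hypotheses on the graphs provide such cut-offs. For subexponential growth (\<open>almost_invariant_subexponential\<close>),
\<open>\<omega> y = exp (- \<epsilon> d y)\<close> on a ball of radius \<open>n\<close>, with \<open>d\<close> the distance from the centre: the exponential makes \<open>\<omega>\<close> vary
slowly inside the ball, and for suitable \<open>n\<close> the jump at the boundary is negligible.
For amenable \<open>\<Gamma>1\<close> and finite \<open>\<Gamma>2\<close> (\<open>almost_invariant_amenable\<close>), \<open>\<omega>\<close> is the indicator function of a Folner set: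
transport along a path changes the number of points of the set in a fibre by at most a multiple of the
size of its boundary, so every fibre carries a fixed proportion of the set, and the boundary is small
relative to each fibre.

Finally, an operator \<open>a\<close> such that \<open>a\<close> and its adjoint are bounded below is invertible
(\<open>bounded_below_imp_invertible\<close>). As \<open>1 - s a a*\<close> is a strict contraction for small \<open>s > 0\<close>, the equation
\<open>a a* u = g\<close> is solved by a Neumann series. The matrices have finite rows, so the series can be summed pointwise
and estimates for finitely supported functions extend to \<open>l\<^sup>2\<close> by looking at finite sets of coordinates.\<close>

section \<open>Square-summable functions\<close>

definition fin_supp :: "'v set \<Rightarrow> ('v \<Rightarrow> complex) \<Rightarrow> bool" where
  "fin_supp V f \<longleftrightarrow> finite {v. f v \<noteq> 0} \<and> {v. f v \<noteq> 0} \<subseteq> V"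

lemma L2_set_sum_le:
  "L2_set (\<lambda>y. \<Sum>e\<in>E. g e y) Y \<le> (\<Sum>e\<in>E. L2_set (g e) Y)"
proof (induction E rule: infinite_finite_induct)
  case (insert e E)
  then show ?case
    using L2_set_triangle_ineq[of "g e" "\<lambda>y. \<Sum>e\<in>E. g e y" Y] by simp
qed (simp_all add: L2_set_def)

lemma L2_set_le_l2_norm:
  assumes "f \<in> l2 V" "finite F" "F \<subseteq> V"
  shows "L2_set (\<lambda>v. cmod (f v)) F \<le> l2_norm V f"
proof -
  have "(\<Sum>v\<in>F. (cmod (f v))\<^sup>2) \<le> (\<Sum>\<^sub>\<infinity>v\<in>V. (cmod (f v))\<^sup>2)"
    using assms by (intro finite_sum_le_infsum) (auto simp: l2_def)
  then show ?thesis
    by (simp add: L2_set_def l2_norm_def)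
qed

text \<open>Membership in \<open>l2\<close> and bounds on the norm are always obtained through finite sets of coordinates, so that
  the estimates below reduce to finite sums.\<close>

lemma l2_normI:
  assumes "\<And>v. v \<notin> V \<Longrightarrow> f v = 0"
    and bound: "\<And>F. finite F \<Longrightarrow> F \<subseteq> V \<Longrightarrow> L2_set (\<lambda>v. cmod (f v)) F \<le> B"
  shows "f \<in> l2 V" and "l2_norm V f \<le> B"
proof -
  have "0 \<le> B"
    using bound[of "{}"] by simp
  have sums: "(\<Sum>v\<in>F. (cmod (f v))\<^sup>2) \<le> B\<^sup>2" if "finite F" "F \<subseteq> V" for F
    using bound[OF that] \<open>0 \<le> B\<close>
    by (simp add: L2_set_def real_sqrt_le_iff sqrt_le_D)
  have summ: "(\<lambda>v. (cmod (f v))\<^sup>2) summable_on V"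
    by (rule nonneg_bounded_partial_sums_imp_summable_on[where C = "B\<^sup>2"])
       (use sums in \<open>auto intro!: eventually_finite_subsets_at_top_weakI\<close>)
  then show "f \<in> l2 V"
    using assms(1) by (simp add: l2_def)
  have "(\<Sum>\<^sub>\<infinity>v\<in>V. (cmod (f v))\<^sup>2) \<le> B\<^sup>2"
    by (rule infsum_le_finite_sums[OF summ]) (use sums in auto)
  then show "l2_norm V f \<le> B"
    using \<open>0 \<le> B\<close> by (simp add: l2_norm_def real_le_lsqrt infsum_nonneg)
qed

lemma l2_norm_nonneg: "0 \<le> l2_norm V f"
  by (simp add: l2_norm_def infsum_nonneg)

lemma l2_zero_outside: "f \<in> l2 V \<Longrightarrow> v \<notin> V \<Longrightarrow> f v = 0"
  by (simp add: l2_def)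

lemma l2_add:
  assumes "f \<in> l2 V" "g \<in> l2 V"
  shows "(\<lambda>v. f v + g v) \<in> l2 V" and "l2_norm V (\<lambda>v. f v + g v) \<le> l2_norm V f + l2_norm V g"
proof -
  have "L2_set (\<lambda>v. cmod (f v + g v)) F \<le> l2_norm V f + l2_norm V g" if "finite F" "F \<subseteq> V" for F
  proof -
    have "L2_set (\<lambda>v. cmod (f v + g v)) F \<le> L2_set (\<lambda>v. cmod (f v) + cmod (g v)) F"
      by (intro L2_set_mono) (auto intro: norm_triangle_ineq)
    also have "\<dots> \<le> L2_set (\<lambda>v. cmod (f v)) F + L2_set (\<lambda>v. cmod (g v)) F"
      by (rule L2_set_triangle_ineq)
    finally show ?thesis
      using L2_set_le_l2_norm[OF assms(1) that] L2_set_le_l2_norm[OF assms(2) that] by linarith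
  qed
  note bound = this
  have out: "f v + g v = 0" if "v \<notin> V" for v
    using assms that by (simp add: l2_zero_outside)
  show "(\<lambda>v. f v + g v) \<in> l2 V"
    by (rule l2_normI(1)[OF out bound])
  show "l2_norm V (\<lambda>v. f v + g v) \<le> l2_norm V f + l2_norm V g"
    by (rule l2_normI(2)[OF out bound])
qed

lemma l2_scale:
  assumes "f \<in> l2 V"
  shows "(\<lambda>v. c * f v) \<in> l2 V" and "l2_norm V (\<lambda>v. c * f v) \<le> cmod c * l2_norm V f"
proof -
  have "L2_set (\<lambda>v. cmod (c * f v)) F \<le> cmod c * l2_norm V f" if "finite F" "F \<subseteq> V" for F
    using L2_set_le_l2_norm[OF assms that]
    by (simp add: norm_mult L2_set_right_distrib[symmetric] mult_left_mono)
  note bound = this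
  have out: "c * f v = 0" if "v \<notin> V" for v
    using assms that by (simp add: l2_zero_outside)
  show "(\<lambda>v. c * f v) \<in> l2 V"
    by (rule l2_normI(1)[OF out bound])
  show "l2_norm V (\<lambda>v. c * f v) \<le> cmod c * l2_norm V f"
    by (rule l2_normI(2)[OF out bound])
qed

lemma l2_diff:
  assumes "f \<in> l2 V" "g \<in> l2 V"
  shows "(\<lambda>v. f v - g v) \<in> l2 V" and "l2_norm V (\<lambda>v. f v - g v) \<le> l2_norm V f + l2_norm V g"
  using l2_add[OF assms(1) l2_scale(1)[OF assms(2), of "- 1"]] l2_scale(2)[OF assms(2), of "- 1"]
  by auto

lemma l2_norm_eq_L2_set:
  assumes "finite S" "S \<subseteq> V" "\<And>v. v \<notin> S \<Longrightarrow> f v = 0"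
  shows "f \<in> l2 V" and "l2_norm V f = L2_set (\<lambda>v. cmod (f v)) S"
proof -
  have le: "L2_set (\<lambda>v. cmod (f v)) F \<le> L2_set (\<lambda>v. cmod (f v)) S" if "finite F" "F \<subseteq> V" for F
  proof -
    have "(\<Sum>v\<in>F. (cmod (f v))\<^sup>2) = (\<Sum>v\<in>F \<inter> S. (cmod (f v))\<^sup>2)"
      using that assms(3) by (intro sum.mono_neutral_right) auto
    also have "\<dots> \<le> (\<Sum>v\<in>S. (cmod (f v))\<^sup>2)"
      using assms(1) by (intro sum_mono2) auto
    finally show ?thesis by (simp add: L2_set_def)
  qed
  have out: "f v = 0" if "v \<notin> V" for v
    using that assms by blast
  show 1: "f \<in> l2 V"
    by (rule l2_normI(1)[OF out le])
  show "l2_norm V f = L2_set (\<lambda>v. cmod (f v)) S"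
    using l2_normI(2)[OF out le] L2_set_le_l2_norm[OF 1 assms(1,2)] by (rule antisym)
qed

lemma fin_supp_l2: "fin_supp V f \<Longrightarrow> f \<in> l2 V"
  by (rule l2_norm_eq_L2_set(1)[of "{v. f v \<noteq> 0}"]) (auto simp: fin_supp_def)

lemma l2_norm_eq_0D:
  assumes "f \<in> l2 V" "l2_norm V f \<le> 0"
  shows "f v = 0"
proof (cases "v \<in> V")
  case True
  then show ?thesis
    using order_trans[OF L2_set_le_l2_norm[OF assms(1), of "{v}"] assms(2)] by simp
qed (use assms in \<open>simp add: l2_zero_outside\<close>)

lemma cmod_le_l2_norm:
  assumes "f \<in> l2 V"
  shows "cmod (f v) \<le> l2_norm V f"
proof (cases "v \<in> V")
  case True
  then show ?thesis
    using L2_set_le_l2_norm[OF assms(1), of "{v}"] by simp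
qed (use assms in \<open>simp add: l2_zero_outside l2_norm_nonneg\<close>)


section \<open>Locally finite matrices\<close>

definition mat_op :: "('v \<Rightarrow> 'v \<Rightarrow> complex) \<Rightarrow> ('v \<Rightarrow> complex) \<Rightarrow> 'v \<Rightarrow> complex" where
  "mat_op a f v = (\<Sum>w | a v w \<noteq> 0. a v w * f w)"

definition conj_transpose :: "('v \<Rightarrow> 'v \<Rightarrow> complex) \<Rightarrow> 'v \<Rightarrow> 'v \<Rightarrow> complex" where
  "conj_transpose a v w = cnj (a w v)"

text \<open>Tested on finitely supported functions: these can be lifted along a covering by means of a cut-off, and for
  locally finite matrices they determine the estimates on \<open>l2\<close> that inversion needs.\<close>

definition bounded_below :: "'v set \<Rightarrow> real \<Rightarrow> ('v \<Rightarrow> 'v \<Rightarrow> complex) \<Rightarrow> bool" where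
  "bounded_below V C a \<longleftrightarrow>
     (\<forall>f. fin_supp V f \<longrightarrow> l2_norm V f \<le> C * l2_norm V (mat_op a f))"

lemma mat_op_add: "mat_op a (\<lambda>v. f v + g v) = (\<lambda>v. mat_op a f v + mat_op a g v)"
  by (rule ext) (simp add: mat_op_def sum.distrib algebra_simps)

lemma mat_op_scale: "mat_op a (\<lambda>v. c * f v) = (\<lambda>v. c * mat_op a f v)"
  by (rule ext) (simp add: mat_op_def sum_distrib_left algebra_simps)

lemma mat_op_diff: "mat_op a (\<lambda>v. f v - g v) = (\<lambda>v. mat_op a f v - mat_op a g v)"
  by (rule ext) (simp add: mat_op_def sum_subtractf algebra_simps)

lemma conj_transpose_conj_transpose: "conj_transpose (conj_transpose a) = a"
  by (simp add: conj_transpose_def fun_eq_iff)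

lemma mat_op_sums:
  assumes "\<And>w. (\<lambda>k. f k w) sums u w"
  shows "(\<lambda>k. mat_op a (f k) v) sums mat_op a u v"
  unfolding mat_op_def by (intro sums_sum sums_mult assms)

text \<open>The bounds on the absolute row and column sums are those of the Schur test; being symmetric, they serve for
  the conjugate transpose too. Taking \<open>K \<ge> 1\<close> keeps the constants of \<open>gram_contraction\<close> in the right range.\<close>

locale locally_finite_matrix =
  fixes V :: "'v set" and a :: "'v \<Rightarrow> 'v \<Rightarrow> complex" and K :: real
  assumes entries_in: "a v w \<noteq> 0 \<Longrightarrow> v \<in> V \<and> w \<in> V"
    and finite_row: "finite {w. a v w \<noteq> 0}"
    and finite_column: "finite {v. a v w \<noteq> 0}"
    and row_sum: "(\<Sum>w | a v w \<noteq> 0. cmod (a v w)) \<le> K"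
    and column_sum: "(\<Sum>v | a v w \<noteq> 0. cmod (a v w)) \<le> K"
    and K_ge_1: "1 \<le> K"
begin

lemma locally_finite_conj_transpose: "locally_finite_matrix V (conj_transpose a) K"
  by unfold_locales
     (use entries_in finite_row finite_column row_sum column_sum K_ge_1 in \<open>auto simp: conj_transpose_def\<close>)

lemma mat_op_eq_sum:
  assumes "finite S" "\<And>w. a v w \<noteq> 0 \<Longrightarrow> f w \<noteq> 0 \<Longrightarrow> w \<in> S"
  shows "mat_op a f v = (\<Sum>w\<in>S. a v w * f w)"
proof -
  have "mat_op a f v = (\<Sum>w\<in>{w. a v w \<noteq> 0} \<union> S. a v w * f w)"
    unfolding mat_op_def using assms finite_row by (intro sum.mono_neutral_left) auto
  also have "\<dots> = (\<Sum>w\<in>S. a v w * f w)"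
    using assms finite_row by (intro sum.mono_neutral_right) auto
  finally show ?thesis .
qed

lemma mat_op_outside: "v \<notin> V \<Longrightarrow> mat_op a f v = 0"
  unfolding mat_op_def using entries_in by (intro sum.neutral) blast

text \<open>The Schur test: by Cauchy-Schwarz, \<open>(\<Sum>w. |a v w| |f w|)\<^sup>2 \<le> (\<Sum>w. |a v w|) (\<Sum>w. |a v w| |f w|\<^sup>2)\<close>; the first
  factor is a row sum, and summing the second over \<open>v\<close> produces column sums.\<close>

lemma mat_op_bounded:
  assumes "f \<in> l2 V"
  shows "mat_op a f \<in> l2 V" and "l2_norm V (mat_op a f) \<le> K * l2_norm V f"
proof -
  have "L2_set (\<lambda>v. cmod (mat_op a f v)) F \<le> K * l2_norm V f" if F: "finite F" "F \<subseteq> V" for F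
  proof -
    define S where "S = (\<Union>v\<in>F. {w. a v w \<noteq> 0})"
    have S: "finite S" "S \<subseteq> V"
      using F finite_row entries_in by (auto simp: S_def)
    have row: "(\<Sum>w\<in>S. cmod (a v w)) \<le> K" for v
    proof -
      have "(\<Sum>w\<in>S. cmod (a v w)) = (\<Sum>w\<in>S \<inter> {w. a v w \<noteq> 0}. cmod (a v w))"
        using S by (intro sum.mono_neutral_right) auto
      also have "\<dots> \<le> (\<Sum>w | a v w \<noteq> 0. cmod (a v w))"
        using finite_row by (intro sum_mono2) auto
      finally show ?thesis using row_sum[of v] by linarith
    qed
    have column: "(\<Sum>v\<in>F. cmod (a v w)) \<le> K" for w
    proof -
      have "(\<Sum>v\<in>F. cmod (a v w)) = (\<Sum>v\<in>F \<inter> {v. a v w \<noteq> 0}. cmod (a v w))"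
        using F by (intro sum.mono_neutral_right) auto
      also have "\<dots> \<le> (\<Sum>v | a v w \<noteq> 0. cmod (a v w))"
        using finite_column by (intro sum_mono2) auto
      finally show ?thesis using column_sum[of w] by linarith
    qed
    have pointwise: "(cmod (mat_op a f v))\<^sup>2 \<le> K * (\<Sum>w\<in>S. cmod (a v w) * (cmod (f w))\<^sup>2)"
      if "v \<in> F" for v
    proof -
      have "mat_op a f v = (\<Sum>w\<in>S. a v w * f w)"
        using that S by (intro mat_op_eq_sum) (auto simp: S_def)
      then have "cmod (mat_op a f v) \<le> (\<Sum>w\<in>S. sqrt (cmod (a v w)) * (sqrt (cmod (a v w)) * cmod (f w)))"
        by (simp add: sum_norm_le norm_mult mult.assoc[symmetric])
      then have "(cmod (mat_op a f v))\<^sup>2 \<le>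
          (\<Sum>w\<in>S. sqrt (cmod (a v w)) * (sqrt (cmod (a v w)) * cmod (f w)))\<^sup>2"
        by (intro power_mono) auto
      also have "\<dots> \<le> (\<Sum>w\<in>S. (sqrt (cmod (a v w)))\<^sup>2) * (\<Sum>w\<in>S. (sqrt (cmod (a v w)) * cmod (f w))\<^sup>2)"
        by (rule Cauchy_Schwarz_ineq_sum)
      also have "\<dots> = (\<Sum>w\<in>S. cmod (a v w)) * (\<Sum>w\<in>S. cmod (a v w) * (cmod (f w))\<^sup>2)"
        by (simp add: power_mult_distrib)
      also have "\<dots> \<le> K * (\<Sum>w\<in>S. cmod (a v w) * (cmod (f w))\<^sup>2)"
        by (intro mult_right_mono row sum_nonneg) auto
      finally show ?thesis .
    qed
    have "(\<Sum>v\<in>F. (cmod (mat_op a f v))\<^sup>2) \<le> (\<Sum>v\<in>F. K * (\<Sum>w\<in>S. cmod (a v w) * (cmod (f w))\<^sup>2))"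
      by (intro sum_mono pointwise)
    also have "\<dots> = K * (\<Sum>w\<in>S. (\<Sum>v\<in>F. cmod (a v w)) * (cmod (f w))\<^sup>2)"
      by (simp add: sum_distrib_left sum_distrib_right sum.swap[of _ S F])
    also have "\<dots> \<le> K * (\<Sum>w\<in>S. K * (cmod (f w))\<^sup>2)"
      using K_ge_1 by (intro mult_left_mono sum_mono mult_right_mono column) auto
    also have "\<dots> = K\<^sup>2 * (\<Sum>w\<in>S. (cmod (f w))\<^sup>2)"
      by (simp add: sum_distrib_left power2_eq_square mult.assoc)
    finally have "L2_set (\<lambda>v. cmod (mat_op a f v)) F \<le> K * L2_set (\<lambda>v. cmod (f v)) S"
      using K_ge_1 real_sqrt_le_mono by (fastforce simp: L2_set_def real_sqrt_mult)
    also have "\<dots> \<le> K * l2_norm V f"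
      using L2_set_le_l2_norm[OF assms S] K_ge_1 by (intro mult_left_mono) auto
    finally show ?thesis .
  qed
  note bound = this
  show "mat_op a f \<in> l2 V"
    by (rule l2_normI(1)[OF mat_op_outside bound])
  show "l2_norm V (mat_op a f) \<le> K * l2_norm V f"
    by (rule l2_normI(2)[OF mat_op_outside bound])
qed

lemma fin_supp_mat_op:
  assumes "fin_supp V f"
  shows "fin_supp V (mat_op a f)"
proof -
  have "mat_op a f v = 0" if "v \<notin> (\<Union>w\<in>{w. f w \<noteq> 0}. {v. a v w \<noteq> 0})" for v
    unfolding mat_op_def using that by (intro sum.neutral) auto
  then have sub: "{v. mat_op a f v \<noteq> 0} \<subseteq> (\<Union>w\<in>{w. f w \<noteq> 0}. {v. a v w \<noteq> 0})"
    by blast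
  moreover have "finite (\<Union>w\<in>{w. f w \<noteq> 0}. {v. a v w \<noteq> 0})"
    using assms finite_column by (auto simp: fin_supp_def)
  ultimately show ?thesis
    unfolding fin_supp_def using mat_op_outside finite_subset by blast
qed

lemma mat_op_conj_transpose:
  assumes g: "finite S" "\<And>v. v \<notin> S \<Longrightarrow> g v = 0"
    and S': "finite S'" "\<And>v w. v \<in> S \<Longrightarrow> a v w \<noteq> 0 \<Longrightarrow> w \<in> S'"
  shows "(\<Sum>v\<in>S. mat_op a f v * cnj (g v)) = (\<Sum>w\<in>S'. f w * cnj (mat_op (conj_transpose a) g w))"
proof -
  interpret adj: locally_finite_matrix V "conj_transpose a" K
    by (rule locally_finite_conj_transpose)
  have 1: "mat_op a f v = (\<Sum>w\<in>S'. a v w * f w)" if "v \<in> S" for v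
    using that S' by (intro mat_op_eq_sum) auto
  have 2: "mat_op (conj_transpose a) g w = (\<Sum>v\<in>S. conj_transpose a w v * g v)" for w
    using g by (intro adj.mat_op_eq_sum) auto
  have "(\<Sum>v\<in>S. mat_op a f v * cnj (g v)) = (\<Sum>v\<in>S. \<Sum>w\<in>S'. a v w * f w * cnj (g v))"
    by (simp add: 1 sum_distrib_right)
  also have "\<dots> = (\<Sum>w\<in>S'. \<Sum>v\<in>S. a v w * f w * cnj (g v))"
    by (rule sum.swap)
  also have "\<dots> = (\<Sum>w\<in>S'. f w * cnj (mat_op (conj_transpose a) g w))"
    by (simp add: 2 conj_transpose_def sum_distrib_left mult_ac)
  finally show ?thesis .
qed

text \<open>The inverse \<open>S\<close> also bounds the adjoint from below, without constructing the adjoint of \<open>S\<close>: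
  \<open>\<parallel>g\<parallel>\<^sup>2 = \<langle>a S g, g\<rangle> = \<langle>S g, a* g\<rangle> \<le> C \<parallel>g\<parallel> \<parallel>a* g\<parallel>\<close>.\<close>

lemma invertible_imp_bounded_below:
  assumes inv: "l2_invertible V T" and T: "\<And>f. f \<in> l2 V \<Longrightarrow> T f = mat_op a f"
  obtains C where "1 \<le> C" "bounded_below V C a" "bounded_below V C (conj_transpose a)"
proof -
  interpret adj: locally_finite_matrix V "conj_transpose a" K
    by (rule locally_finite_conj_transpose)
  obtain S C0 where S_l2: "\<And>f. f \<in> l2 V \<Longrightarrow> S f \<in> l2 V"
    and S_inv: "\<And>f. f \<in> l2 V \<Longrightarrow> S (T f) = f \<and> T (S f) = f"
    and C0: "\<And>f. f \<in> l2 V \<Longrightarrow> l2_norm V (S f) \<le> C0 * l2_norm V f"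
    using inv unfolding l2_invertible_def l2_bounded_operator_def by blast
  define C where "C = max 1 C0"
  have S_bound: "l2_norm V (S f) \<le> C * l2_norm V f" if "f \<in> l2 V" for f
    using C0[OF that] mult_right_mono[of C0 C "l2_norm V f"] l2_norm_nonneg[of V f]
    by (simp add: C_def)
  have "l2_norm V f \<le> C * l2_norm V (mat_op a f)" if "fin_supp V f" for f
    using S_bound[of "mat_op a f"] S_inv[of f] T[of f] mat_op_bounded(1)[of f] fin_supp_l2[OF that]
    by auto
  then have "bounded_below V C a"
    by (simp add: bounded_below_def)
  moreover have "l2_norm V g \<le> C * l2_norm V (mat_op (conj_transpose a) g)" if g: "fin_supp V g" for g
  proof -
    define S0 where "S0 = {v. g v \<noteq> 0}"
    have S0: "finite S0" "S0 \<subseteq> V" "\<And>v. v \<notin> S0 \<Longrightarrow> g v = 0"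
      using g by (auto simp: S0_def fin_supp_def)
    define S1 where "S1 = (\<Union>v\<in>S0. {w. a v w \<noteq> 0})"
    have S1: "finite S1" "S1 \<subseteq> V"
      using S0 finite_row entries_in by (auto simp: S1_def)
    have g_l2: "g \<in> l2 V" "l2_norm V g = L2_set (\<lambda>v. cmod (g v)) S0"
      using l2_norm_eq_L2_set[OF S0] by auto
    let ?f = "S g"
    have f_l2: "?f \<in> l2 V"
      using g_l2 S_l2 by blast
    have "complex_of_real ((l2_norm V g)\<^sup>2) = (\<Sum>v\<in>S0. g v * cnj (g v))"
      by (simp add: g_l2 L2_set_def sum_nonneg flip: complex_norm_square)
    also have "\<dots> = (\<Sum>v\<in>S0. mat_op a ?f v * cnj (g v))"
      using S_inv[OF g_l2(1)] T[OF f_l2] by simp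
    also have "\<dots> = (\<Sum>w\<in>S1. ?f w * cnj (mat_op (conj_transpose a) g w))"
      using S0 S1 by (intro mat_op_conj_transpose) (auto simp: S1_def)
    finally have "(l2_norm V g)\<^sup>2 = cmod (\<Sum>w\<in>S1. ?f w * cnj (mat_op (conj_transpose a) g w))"
      by (metis norm_of_real abs_power2)
    also have "\<dots> \<le> (\<Sum>w\<in>S1. \<bar>cmod (?f w)\<bar> * \<bar>cmod (mat_op (conj_transpose a) g w)\<bar>)"
      by (rule sum_norm_le) (simp add: norm_mult)
    also have "\<dots> \<le> L2_set (\<lambda>w. cmod (?f w)) S1 * L2_set (\<lambda>w. cmod (mat_op (conj_transpose a) g w)) S1"
      by (rule L2_set_mult_ineq)
    also have "\<dots> \<le> l2_norm V ?f * l2_norm V (mat_op (conj_transpose a) g)"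
      using f_l2 g_l2 S1 adj.mat_op_bounded(1)
      by (intro mult_mono L2_set_le_l2_norm) (auto simp: l2_norm_nonneg)
    also have "\<dots> \<le> C * l2_norm V g * l2_norm V (mat_op (conj_transpose a) g)"
      by (intro mult_right_mono S_bound g_l2 l2_norm_nonneg)
    finally have "l2_norm V g * l2_norm V g \<le> l2_norm V g * (C * l2_norm V (mat_op (conj_transpose a) g))"
      by (simp add: power2_eq_square mult_ac)
    moreover have "0 \<le> C * l2_norm V (mat_op (conj_transpose a) g)"
      by (simp add: C_def l2_norm_nonneg)
    ultimately show ?thesis
      using l2_norm_nonneg[of V g] mult_le_cancel_left_pos[of "l2_norm V g"] by fastforce
  qed
  then have "bounded_below V C (conj_transpose a)"
    by (simp add: bounded_below_def)
  ultimately show thesis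
    using that[of C] by (simp add: C_def)
qed

end


section \<open>Inversion by a Neumann series\<close>

context locally_finite_matrix
begin

text \<open>Write \<open>P = a a*\<close>. Then \<open>\<parallel>u - s P u\<parallel>\<^sup>2 = \<parallel>u\<parallel>\<^sup>2 - 2 s \<parallel>a* u\<parallel>\<^sup>2 + s\<^sup>2 \<parallel>P u\<parallel>\<^sup>2\<close>, where \<open>\<parallel>a* u\<parallel> \<ge> \<parallel>u\<parallel> / C\<close> and
  \<open>\<parallel>P u\<parallel> \<le> K\<^sup>2 \<parallel>u\<parallel>\<close>. The value of \<open>s\<close> minimizes the resulting quadratic polynomial.\<close>

lemma gram_contraction_fin_supp:
  assumes C: "1 \<le> C" "bounded_below V C (conj_transpose a)" and u: "fin_supp V u"
  shows "l2_norm V (\<lambda>v. u v - complex_of_real (1 / (C\<^sup>2 * K ^ 4)) * mat_op a (mat_op (conj_transpose a) u) v)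
           \<le> sqrt (1 - 1 / (C ^ 4 * K ^ 4)) * l2_norm V u"
proof -
  interpret adj: locally_finite_matrix V "conj_transpose a" K
    by (rule locally_finite_conj_transpose)
  define s where "s = 1 / (C\<^sup>2 * K ^ 4)"
  define w where "w = mat_op (conj_transpose a) u"
  define P where "P = mat_op a w"
  define S where "S = {v. u v \<noteq> 0} \<union> {v. P v \<noteq> 0}"
  define S' where "S' = {v. w v \<noteq> 0} \<union> (\<Union>v\<in>S. {w. a v w \<noteq> 0})"
  have fin: "fin_supp V w" "fin_supp V P"
    using u by (auto simp: w_def P_def intro: adj.fin_supp_mat_op fin_supp_mat_op)
  have S: "finite S" "S \<subseteq> V" "\<And>v. v \<notin> S \<Longrightarrow> u v = 0" "\<And>v. v \<notin> S \<Longrightarrow> P v = 0"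
    using u fin by (auto simp: S_def fin_supp_def)
  have S': "finite S'" "S' \<subseteq> V" "\<And>v. v \<notin> S' \<Longrightarrow> w v = 0"
    using S fin finite_row entries_in by (auto simp: S'_def fin_supp_def)
  let ?nu = "l2_norm V u"
  have u2: "?nu\<^sup>2 = (\<Sum>v\<in>S. (cmod (u v))\<^sup>2)"
    by (simp add: l2_norm_eq_L2_set[OF S(1-3)] L2_set_def sum_nonneg)
  have P2: "(l2_norm V P)\<^sup>2 = (\<Sum>v\<in>S. (cmod (P v))\<^sup>2)"
    by (simp add: l2_norm_eq_L2_set[OF S(1,2,4)] L2_set_def sum_nonneg)
  have w2: "(l2_norm V w)\<^sup>2 = (\<Sum>v\<in>S'. (cmod (w v))\<^sup>2)"
    by (simp add: l2_norm_eq_L2_set[OF S'] L2_set_def sum_nonneg)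
  have "(\<Sum>v\<in>S. P v * cnj (u v)) = (\<Sum>v\<in>S'. w v * cnj (w v))"
    unfolding P_def using S S' mat_op_conj_transpose[of S u S' w] by (auto simp: w_def S'_def)
  also have "\<dots> = complex_of_real ((l2_norm V w)\<^sup>2)"
    unfolding w2 by (simp add: complex_norm_square[symmetric])
  finally have "Re (\<Sum>v\<in>S. P v * cnj (u v)) = (l2_norm V w)\<^sup>2"
    by (simp only: Re_complex_of_real)
  then have inner: "(\<Sum>v\<in>S. Re (P v * cnj (u v))) = (l2_norm V w)\<^sup>2"
    by (simp only: Re_sum)
  have "l2_norm V (\<lambda>v. u v - of_real s * P v) = L2_set (\<lambda>v. cmod (u v - of_real s * P v)) S"
    using S by (intro l2_norm_eq_L2_set) auto
  then have "(l2_norm V (\<lambda>v. u v - of_real s * P v))\<^sup>2 = (\<Sum>v\<in>S. (cmod (u v - of_real s * P v))\<^sup>2)"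
    by (simp add: L2_set_def sum_nonneg)
  also have "\<dots> = (\<Sum>v\<in>S. (cmod (u v))\<^sup>2 - 2 * s * Re (P v * cnj (u v)) + s\<^sup>2 * (cmod (P v))\<^sup>2)"
    by (intro sum.cong refl) (simp only: cmod_power2, simp add: power2_eq_square algebra_simps)
  also have "\<dots> = ?nu\<^sup>2 - 2 * s * (l2_norm V w)\<^sup>2 + s\<^sup>2 * (l2_norm V P)\<^sup>2"
    unfolding u2 P2 inner[symmetric] by (simp only: sum.distrib sum_subtractf sum_distrib_left)
  also have "\<dots> \<le> ?nu\<^sup>2 - 2 * s * (?nu\<^sup>2 / C\<^sup>2) + s\<^sup>2 * (K ^ 4 * ?nu\<^sup>2)"
  proof -
    have "?nu \<le> C * l2_norm V w"
      using C(2) u by (simp add: bounded_below_def w_def)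
    then have "?nu\<^sup>2 \<le> C\<^sup>2 * (l2_norm V w)\<^sup>2"
      using l2_norm_nonneg[of V u] by (metis power_mono power_mult_distrib)
    then have 1: "?nu\<^sup>2 / C\<^sup>2 \<le> (l2_norm V w)\<^sup>2"
      using C by (simp add: divide_simps mult.commute)
    have "l2_norm V P \<le> K * l2_norm V w"
      using fin mat_op_bounded(2) fin_supp_l2 unfolding P_def by blast
    also have "\<dots> \<le> K * (K * ?nu)"
      using u adj.mat_op_bounded(2) fin_supp_l2 K_ge_1 unfolding w_def by (intro mult_left_mono) auto
    finally have "(l2_norm V P)\<^sup>2 \<le> (K * (K * ?nu))\<^sup>2"
      by (intro power_mono l2_norm_nonneg)
    then have 2: "(l2_norm V P)\<^sup>2 \<le> K ^ 4 * ?nu\<^sup>2"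
      by (simp add: power_mult_distrib power4_eq_xxxx power2_eq_square mult_ac)
    have "0 \<le> s"
      using C K_ge_1 by (simp add: s_def)
    have "2 * s * (?nu\<^sup>2 / C\<^sup>2) \<le> 2 * s * (l2_norm V w)\<^sup>2"
      using \<open>0 \<le> s\<close> 1 by (intro mult_left_mono) auto
    moreover have "s\<^sup>2 * (l2_norm V P)\<^sup>2 \<le> s\<^sup>2 * (K ^ 4 * ?nu\<^sup>2)"
      by (intro mult_left_mono 2) auto
    ultimately show ?thesis by linarith
  qed
  also have "\<dots> = (1 - 1 / (C ^ 4 * K ^ 4)) * ?nu\<^sup>2"
  proof -
    have "C \<noteq> 0" "K \<noteq> 0" using C K_ge_1 by auto
    then show ?thesis
      by (simp add: s_def field_simps power2_eq_square power4_eq_xxxx)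
  qed
  finally have "(l2_norm V (\<lambda>v. u v - of_real s * P v))\<^sup>2 \<le> (1 - 1 / (C ^ 4 * K ^ 4)) * ?nu\<^sup>2" .
  then have "l2_norm V (\<lambda>v. u v - of_real s * P v) \<le> sqrt ((1 - 1 / (C ^ 4 * K ^ 4)) * ?nu\<^sup>2)"
    by (rule real_le_rsqrt)
  also have "\<dots> = sqrt (1 - 1 / (C ^ 4 * K ^ 4)) * ?nu"
    by (simp add: real_sqrt_mult l2_norm_nonneg)
  finally show ?thesis
    unfolding s_def P_def w_def .
qed

text \<open>The contraction estimate extends from finitely supported functions to \<open>l2\<close> because the values of
  \<open>u - s P u\<close> on a finite set depend on the values of \<open>u\<close> on a finite set.\<close>

lemma gram_contraction:
  assumes C: "1 \<le> C" "bounded_below V C (conj_transpose a)"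
  obtains s \<rho> :: real where "0 < s" "0 \<le> \<rho>" "\<rho> < 1"
    "\<And>u. u \<in> l2 V \<Longrightarrow>
       l2_norm V (\<lambda>v. u v - complex_of_real s * mat_op a (mat_op (conj_transpose a) u) v) \<le> \<rho> * l2_norm V u"
proof -
  interpret adj: locally_finite_matrix V "conj_transpose a" K
    by (rule locally_finite_conj_transpose)
  define s where "s = 1 / (C\<^sup>2 * K ^ 4)"
  define \<rho> where "\<rho> = sqrt (1 - 1 / (C ^ 4 * K ^ 4))"
  define L where "L u v = u v - complex_of_real s * mat_op a (mat_op (conj_transpose a) u) v" for u v
  have "1 \<le> C ^ 4 * K ^ 4"
    using C K_ge_1 mult_mono[of 1 "C ^ 4" 1 "K ^ 4"] by (simp add: one_le_power)
  then have \<rho>: "0 \<le> \<rho>" "\<rho> < 1"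
    by (auto simp: \<rho>_def)
  have bound: "l2_norm V (L u) \<le> \<rho> * l2_norm V u" if u: "u \<in> l2 V" for u
  proof (rule l2_normI(2))
    show "L u v = 0" if "v \<notin> V" for v
      using u that by (simp add: L_def mat_op_outside l2_zero_outside)
    fix F assume F: "finite F" "F \<subseteq> V"
    \<comment> \<open>all coordinates of \<open>u\<close> that enter \<open>L u\<close> on \<open>F\<close>\<close>
    define A where "A = F \<union> (\<Union>v\<in>F. \<Union>w\<in>{w. a v w \<noteq> 0}. {v'. conj_transpose a w v' \<noteq> 0})"
    define u' where "u' v = (if v \<in> A then u v else 0)" for v
    have A: "finite A" "A \<subseteq> V"
      using F finite_row adj.finite_row adj.entries_in by (auto simp: A_def)
    have u': "fin_supp V u'"
      using A by (auto simp: fin_supp_def u'_def intro: finite_subset)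
    have "mat_op (conj_transpose a) u w = mat_op (conj_transpose a) u' w"
      if "v \<in> F" "a v w \<noteq> 0" for v w
      unfolding mat_op_def using that by (intro sum.cong) (auto simp: u'_def A_def)
    then have "mat_op a (mat_op (conj_transpose a) u) v = mat_op a (mat_op (conj_transpose a) u') v"
      if "v \<in> F" for v
      unfolding mat_op_def[of a] using that by (intro sum.cong) auto
    then have local: "L u v = L u' v" if "v \<in> F" for v
      using that by (simp add: L_def u'_def A_def)
    have "{v. L u' v \<noteq> 0} \<subseteq> {v. u' v \<noteq> 0} \<union> {v. mat_op a (mat_op (conj_transpose a) u') v \<noteq> 0}"
      by (auto simp: L_def)
    then have "fin_supp V (L u')"
      using u' fin_supp_mat_op[OF adj.fin_supp_mat_op[OF u']] finite_subset[of "{v. L u' v \<noteq> 0}"]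
      unfolding fin_supp_def by blast
    then have "L2_set (\<lambda>v. cmod (L u' v)) F \<le> l2_norm V (L u')"
      using F by (intro L2_set_le_l2_norm fin_supp_l2)
    also have "\<dots> \<le> \<rho> * l2_norm V u'"
      unfolding L_def \<rho>_def s_def by (rule gram_contraction_fin_supp[OF C u'])
    also have "l2_norm V u' \<le> l2_norm V u"
    proof -
      have "l2_norm V u' = L2_set (\<lambda>v. cmod (u' v)) A"
        using A by (intro l2_norm_eq_L2_set) (auto simp: u'_def)
      also have "\<dots> = L2_set (\<lambda>v. cmod (u v)) A"
        by (intro L2_set_cong) (auto simp: u'_def)
      finally show ?thesis
        using L2_set_le_l2_norm[OF u A] by simp
    qed
    finally show "L2_set (\<lambda>v. cmod (L u v)) F \<le> \<rho> * l2_norm V u"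
      using \<rho> local by (simp add: mult_left_mono cong: L2_set_cong)
  qed
  show thesis
  proof (rule that[of s \<rho>])
    show "0 < s" using C K_ge_1 by (simp add: s_def)
  qed (use \<rho> bound in \<open>auto simp: L_def[abs_def]\<close>)
qed

text \<open>The iterates \<open>f k = (1 - s P)\<^sup>k (s g)\<close> decay geometrically in norm, so their sum \<open>u\<close> exists pointwise and lies in
  \<open>l2\<close>. Every row of \<open>P\<close> being finite, \<open>P\<close> may be applied term by term, and \<open>s P (f k) = f k - f (k + 1)\<close> telescopes
  to \<open>s P u = f 0 = s g\<close>.\<close>

lemma gram_surjective:
  assumes C: "1 \<le> C" "bounded_below V C (conj_transpose a)" and g: "g \<in> l2 V"
  obtains u where "u \<in> l2 V" "mat_op a (mat_op (conj_transpose a) u) = g"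
proof -
  interpret adj: locally_finite_matrix V "conj_transpose a" K
    by (rule locally_finite_conj_transpose)
  obtain s \<rho> :: real where s: "0 < s" and \<rho>: "0 \<le> \<rho>" "\<rho> < 1"
    and contr: "\<And>u. u \<in> l2 V \<Longrightarrow>
       l2_norm V (\<lambda>v. u v - complex_of_real s * mat_op a (mat_op (conj_transpose a) u) v) \<le> \<rho> * l2_norm V u"
    using gram_contraction[OF C] by blast
  define P where "P u = mat_op a (mat_op (conj_transpose a) u)" for u
  define L where "L u v = u v - complex_of_real s * P u v" for u v
  define f where "f k = (L ^^ k) (\<lambda>v. of_real s * g v)" for k
  have f_Suc: "f (Suc k) = L (f k)" for k
    by (simp add: f_def)
  have f_l2: "f k \<in> l2 V" for k
  proof (induction k)
    case 0
    then show ?case using l2_scale(1)[OF g] by (simp add: f_def)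
  next
    case (Suc k)
    then show ?case
      unfolding f_Suc L_def P_def by (intro l2_diff(1) l2_scale(1) mat_op_bounded(1) adj.mat_op_bounded(1))
  qed
  define M where "M = l2_norm V (f 0)"
  have f_norm: "l2_norm V (f k) \<le> M * \<rho> ^ k" for k
  proof (induction k)
    case (Suc k)
    have "l2_norm V (f (Suc k)) \<le> \<rho> * l2_norm V (f k)"
      unfolding f_Suc L_def[abs_def] P_def by (rule contr[OF f_l2])
    also have "\<dots> \<le> \<rho> * (M * \<rho> ^ k)"
      using Suc \<rho> by (intro mult_left_mono)
    finally show ?case by (simp add: mult_ac)
  qed (simp add: M_def)
  have geo: "summable (\<lambda>k. M * \<rho> ^ k)"
    using \<rho> by (intro summable_mult summable_geometric) simp
  have f_summable: "summable (\<lambda>k. f k v)" for v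
    using cmod_le_l2_norm[OF f_l2] f_norm by (intro summable_comparison_test'[OF geo]) (blast intro: order_trans)
  define u where "u v = (\<Sum>k. f k v)" for v
  have u_sums: "(\<lambda>k. f k v) sums u v" for v
    unfolding u_def by (rule summable_sums[OF f_summable])
  have partial: "(\<lambda>v. \<Sum>k<n. f k v) \<in> l2 V \<and> l2_norm V (\<lambda>v. \<Sum>k<n. f k v) \<le> (\<Sum>k<n. M * \<rho> ^ k)" for n
  proof (induction n)
    case 0
    show ?case using l2_norm_eq_L2_set[of "{}" V "\<lambda>_. 0"] by simp
  next
    case (Suc n)
    show ?case
      using l2_add[OF conjunct1[OF Suc] f_l2[of n]] Suc f_norm[of n] by simp
  qed
  have "u \<in> l2 V"
  proof (rule l2_normI(1))
    show "u v = 0" if "v \<notin> V" for v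
      using l2_zero_outside[OF f_l2 that] by (simp add: u_def)
    fix F assume F: "finite F" "F \<subseteq> V"
    have "(\<lambda>n. L2_set (\<lambda>v. cmod (\<Sum>k<n. f k v)) F) \<longlonglongrightarrow> L2_set (\<lambda>v. cmod (u v)) F"
      unfolding L2_set_def using u_sums by (intro tendsto_intros) (auto simp: sums_def)
    moreover have "L2_set (\<lambda>v. cmod (\<Sum>k<n. f k v)) F \<le> (\<Sum>k. M * \<rho> ^ k)" for n
    proof -
      have "L2_set (\<lambda>v. cmod (\<Sum>k<n. f k v)) F \<le> l2_norm V (\<lambda>v. \<Sum>k<n. f k v)"
        using partial F by (intro L2_set_le_l2_norm) auto
      also have "\<dots> \<le> (\<Sum>k<n. M * \<rho> ^ k)"
        using partial by blast
      also have "\<dots> \<le> (\<Sum>k. M * \<rho> ^ k)"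
        using \<rho> geo by (intro sum_le_suminf) (auto simp: M_def l2_norm_nonneg)
      finally show ?thesis .
    qed
    ultimately show "L2_set (\<lambda>v. cmod (u v)) F \<le> (\<Sum>k. M * \<rho> ^ k)"
      by (intro LIMSEQ_le_const2) auto
  qed
  moreover have "P u v = g v" for v
  proof -
    have "(\<lambda>k. P (f k) v) sums P u v"
      unfolding P_def by (intro mat_op_sums u_sums)
    then have "(\<lambda>k. of_real s * P (f k) v) sums (of_real s * P u v)"
      by (rule sums_mult)
    moreover have "of_real s * P (f k) v = f k v - f (Suc k) v" for k
      by (simp add: f_Suc L_def)
    ultimately have "(\<lambda>k. f k v - f (Suc k) v) sums (of_real s * P u v)"
      by simp
    moreover have "(\<lambda>k. f k v - f (Suc k) v) sums (f 0 v - 0)"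
      by (rule telescope_sums') (rule summable_LIMSEQ_zero[OF f_summable])
    ultimately have "of_real s * P u v = f 0 v"
      using sums_unique2 by fastforce
    then show ?thesis
      using s by (simp add: f_def)
  qed
  ultimately show thesis
    using that[of u] unfolding P_def by blast
qed

text \<open>Surjectivity comes from \<open>gram_surjective\<close>. The estimate \<open>\<parallel>u\<parallel> \<le> B \<parallel>a u\<parallel>\<close> on all of \<open>l2\<close>, which gives injectivity and
  the boundedness of the inverse, comes from the contraction \<open>1 - s a* a\<close>, that is, from \<open>gram_contraction\<close> for
  the conjugate transpose.\<close>

lemma bounded_below_imp_invertible:
  assumes C: "1 \<le> C" "bounded_below V C a" "bounded_below V C (conj_transpose a)"
    and T: "\<And>f. f \<in> l2 V \<Longrightarrow> T f = mat_op a f"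
  shows "l2_invertible V T"
proof -
  interpret adj: locally_finite_matrix V "conj_transpose a" K
    by (rule locally_finite_conj_transpose)
  obtain s \<rho> :: real where s: "0 < s" and \<rho>: "0 \<le> \<rho>" "\<rho> < 1"
    and contr: "\<And>u. u \<in> l2 V \<Longrightarrow>
       l2_norm V (\<lambda>v. u v - complex_of_real s * mat_op (conj_transpose a) (mat_op a u) v) \<le> \<rho> * l2_norm V u"
    using adj.gram_contraction[of C] C by (auto simp: conj_transpose_conj_transpose)
  define B where "B = s * K / (1 - \<rho>)"
  have lower: "l2_norm V u \<le> B * l2_norm V (mat_op a u)" if u: "u \<in> l2 V" for u
  proof -
    let ?g = "\<lambda>v. complex_of_real s * mat_op (conj_transpose a) (mat_op a u) v"
    have au: "mat_op a u \<in> l2 V" "mat_op (conj_transpose a) (mat_op a u) \<in> l2 V"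
      using u mat_op_bounded(1) adj.mat_op_bounded(1) by auto
    have "?g \<in> l2 V" "l2_norm V ?g \<le> s * l2_norm V (mat_op (conj_transpose a) (mat_op a u))"
      using l2_scale[OF au(2), of "complex_of_real s"] s by auto
    moreover have "s * l2_norm V (mat_op (conj_transpose a) (mat_op a u)) \<le> s * (K * l2_norm V (mat_op a u))"
      using s by (intro mult_left_mono adj.mat_op_bounded(2) au) auto
    moreover have "l2_norm V u \<le> l2_norm V (\<lambda>v. u v - ?g v) + l2_norm V ?g"
      using l2_add(2)[OF l2_diff(1)[OF u \<open>?g \<in> l2 V\<close>] \<open>?g \<in> l2 V\<close>] by simp
    ultimately have "(1 - \<rho>) * l2_norm V u \<le> s * K * l2_norm V (mat_op a u)"
      using contr[OF u] by (simp add: algebra_simps)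
    then show ?thesis
      using \<rho> by (simp add: B_def field_simps)
  qed
  have inj: "f = g" if "f \<in> l2 V" "g \<in> l2 V" "mat_op a f = mat_op a g" for f g
  proof
    fix v
    let ?d = "\<lambda>v. f v - g v"
    have "l2_norm V (\<lambda>v. 0 :: complex) = 0"
      using l2_norm_eq_L2_set[of "{}" V "\<lambda>_. 0"] by simp
    then have "l2_norm V ?d \<le> 0"
      using lower[OF l2_diff(1)[OF that(1,2)]] that(3) by (simp add: mat_op_diff)
    then have "?d v = 0"
      by (intro l2_norm_eq_0D[of ?d V] l2_diff(1) that)
    then show "f v = g v" by simp
  qed
  have surj: "\<exists>w. w \<in> l2 V \<and> mat_op a w = g" if "g \<in> l2 V" for g
    using gram_surjective[OF C(1,3) that] adj.mat_op_bounded(1) by metis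
  define S where "S g = (SOME w. w \<in> l2 V \<and> mat_op a w = g)" for g
  have S: "S g \<in> l2 V \<and> mat_op a (S g) = g" if "g \<in> l2 V" for g
    unfolding S_def by (rule someI_ex[OF surj[OF that]])
  show ?thesis
    unfolding l2_invertible_def
  proof (intro exI[of _ S] conjI ballI)
    show "l2_bounded_operator V S"
      unfolding l2_bounded_operator_def
    proof (intro conjI ballI allI exI[of _ B])
      fix f g assume fg: "f \<in> l2 V" "g \<in> l2 V"
      show "S (\<lambda>v. f v + g v) = (\<lambda>v. S f v + S g v)"
        using S[OF fg(1)] S[OF fg(2)] S[OF l2_add(1)[OF fg]] l2_add(1)[of "S f" V "S g"]
        by (rule_tac inj) (simp_all add: mat_op_add)
    next
      fix c f assume f: "f \<in> l2 V"
      show "S (\<lambda>v. c * f v) = (\<lambda>v. c * S f v)"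
        using S[OF f] S[OF l2_scale(1)[OF f, of c]] l2_scale(1)[of "S f" V c]
        by (rule_tac inj) (simp_all add: mat_op_scale)
    next
      fix f assume "f \<in> l2 V"
      then show "l2_norm V (S f) \<le> B * l2_norm V f" "S f \<in> l2 V"
        using lower[of "S f"] S[of f] by simp_all
    qed
    fix f assume f: "f \<in> l2 V"
    show "S (T f) = f"
      unfolding T[OF f] using S[OF mat_op_bounded(1)[OF f]] f by (rule_tac inj) blast+
    show "T (S f) = f"
      using S[OF f] T[of "S f"] by simp
  qed
qed

end


section \<open>Laplace type operators as matrices\<close>

lemma other_end_eq: "ends G e = {v, w} \<Longrightarrow> other_end G v e = w"
  unfolding other_end_def by (rule the_equality) (auto simp: doubleton_eq_iff)

lemma edge_endpoints:
  assumes "is_mgraph G" "e \<in> edges_at G v"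
  shows "v \<in> verts G" "other_end G v e \<in> verts G" "ends G e = {v, other_end G v e}"
    "e \<in> edges_at G (other_end G v e)" "other_end G (other_end G v e) e = v"
proof -
  obtain u w where uw: "u \<in> verts G" "w \<in> verts G" "ends G e = {u, w}" "e \<in> edges G" "v \<in> {u, w}"
    using assms by (auto simp: is_mgraph_def edges_at_def)
  then obtain w' where w': "w' \<in> verts G" "ends G e = {v, w'}"
    by (auto simp: insert_commute)
  then have "other_end G v e = w'" "other_end G w' e = v"
    using other_end_eq[of G e] by (auto simp: insert_commute)
  then show "v \<in> verts G" "other_end G v e \<in> verts G" "ends G e = {v, other_end G v e}"
    "e \<in> edges_at G (other_end G v e)" "other_end G (other_end G v e) e = v"
    using uw w' by (auto simp: edges_at_def)
qed

lemma edges_at_other_end_eq: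
  assumes "is_mgraph G"
  shows "{e \<in> edges_at G v. other_end G v e = w} = {e \<in> edges G. ends G e = {v, w}}"
  using edge_endpoints(3)[OF assms, of _ v] other_end_eq[of G _ v w] by (auto simp: edges_at_def)

lemma edges_at_outside: "is_mgraph G \<Longrightarrow> v \<notin> verts G \<Longrightarrow> edges_at G v = {}"
  using edge_endpoints(1) by fastforce

lemma finite_edges_at: "is_mgraph G \<Longrightarrow> finite (edges_at G v)"
  by (cases "v \<in> verts G") (auto simp: edges_at_outside, auto simp: is_mgraph_def bounded_degree_def)

text \<open>The matrix of \<open>H - c\<close>. The weights are a separate argument so that the same graph can carry the
  adjoint weights.\<close>

definition laplace_matrix ::
  "('v, 'e, 'z) mgraph_scheme \<Rightarrow> ('v \<Rightarrow> 'e \<Rightarrow> complex) \<Rightarrow> complex \<Rightarrow> 'v \<Rightarrow> 'v \<Rightarrow> complex" where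
  "laplace_matrix G \<alpha> c v w =
     (\<Sum>e | e \<in> edges G \<and> ends G e = {v, w}. \<alpha> v e) - (if v = w \<and> v \<in> verts G then c else 0)"

definition adjoint_weight ::
  "('v, 'e, 'z) mgraph_scheme \<Rightarrow> ('v \<Rightarrow> 'e \<Rightarrow> complex) \<Rightarrow> 'v \<Rightarrow> 'e \<Rightarrow> complex" where
  "adjoint_weight G \<alpha> v e = cnj (\<alpha> (other_end G v e) e)"

lemma conj_transpose_laplace_matrix:
  "conj_transpose (laplace_matrix G \<alpha> c) = laplace_matrix G (adjoint_weight G \<alpha>) (cnj c)"
proof (intro ext)
  fix v w
  have "(\<Sum>e | e \<in> edges G \<and> ends G e = {w, v}. cnj (\<alpha> w e))
      = (\<Sum>e | e \<in> edges G \<and> ends G e = {v, w}. adjoint_weight G \<alpha> v e)"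
    by (intro sum.cong) (auto simp: adjoint_weight_def insert_commute other_end_eq)
  then show "conj_transpose (laplace_matrix G \<alpha> c) v w = laplace_matrix G (adjoint_weight G \<alpha>) (cnj c) v w"
    by (auto simp: conj_transpose_def laplace_matrix_def)
qed

context
  fixes G :: "('v, 'e, 'z) mgraph_scheme" and \<alpha> :: "'v \<Rightarrow> 'e \<Rightarrow> complex" and c :: complex
  assumes G: "is_mgraph G"
begin

lemma laplace_matrix_row:
  "{w. laplace_matrix G \<alpha> c v w \<noteq> 0} \<subseteq> insert v (other_end G v ` edges_at G v)"
proof
  fix w assume w: "w \<in> {w. laplace_matrix G \<alpha> c v w \<noteq> 0}"
  show "w \<in> insert v (other_end G v ` edges_at G v)"
  proof (rule ccontr)
    assume "w \<notin> insert v (other_end G v ` edges_at G v)"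
    then have "{e \<in> edges G. ends G e = {v, w}} = {}" "v \<noteq> w"
      unfolding edges_at_other_end_eq[OF G, symmetric] by auto
    then show False
      using w by (simp only: laplace_matrix_def mem_Collect_eq) simp
  qed
qed

lemma laplace_matrix_entries:
  assumes "laplace_matrix G \<alpha> c v w \<noteq> 0"
  shows "v \<in> verts G \<and> w \<in> verts G"
proof (cases "\<exists>e. e \<in> edges G \<and> ends G e = {v, w}")
  case True
  then show ?thesis
    using G by (auto simp: is_mgraph_def doubleton_eq_iff)
next
  case False
  then have "{e \<in> edges G. ends G e = {v, w}} = {}"
    by blast
  then have "laplace_matrix G \<alpha> c v w = - (if v = w \<and> v \<in> verts G then c else 0)"
    by (simp only: laplace_matrix_def) simp
  then show ?thesis
    using assms by (auto split: if_splits)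
qed

lemma mat_op_laplace_matrix:
  assumes "v \<in> verts G"
  shows "mat_op (laplace_matrix G \<alpha> c) f v
           = (\<Sum>e\<in>edges_at G v. \<alpha> v e * f (other_end G v e)) - c * f v"
proof -
  define S where "S = insert v (other_end G v ` edges_at G v)"
  have fin: "finite (edges_at G v)" "finite S"
    using finite_edges_at[OF G] by (auto simp: S_def)
  have "mat_op (laplace_matrix G \<alpha> c) f v = (\<Sum>w\<in>S. laplace_matrix G \<alpha> c v w * f w)"
    unfolding mat_op_def using laplace_matrix_row[of v] fin(2) unfolding S_def
    by (intro sum.mono_neutral_left) auto
  also have "\<dots> = (\<Sum>w\<in>S. (\<Sum>e | e \<in> edges_at G v \<and> other_end G v e = w. \<alpha> v e * f (other_end G v e))
                      - (if w = v then c * f v else 0))"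
    using assms
    by (intro sum.cong) (auto simp: laplace_matrix_def left_diff_distrib sum_distrib_right
        edges_at_other_end_eq[OF G, symmetric] intro!: sum.cong)
  also have "\<dots> = (\<Sum>w\<in>S. \<Sum>e | e \<in> edges_at G v \<and> other_end G v e = w. \<alpha> v e * f (other_end G v e)) - c * f v"
    using fin by (simp add: sum_subtractf S_def)
  also have "(\<Sum>w\<in>S. \<Sum>e | e \<in> edges_at G v \<and> other_end G v e = w. \<alpha> v e * f (other_end G v e))
      = (\<Sum>e\<in>edges_at G v. \<alpha> v e * f (other_end G v e))"
    using fin by (intro sum.group) (auto simp: S_def)
  finally show ?thesis .
qed

lemma laplace_matrix_row_sum:
  assumes "v \<in> verts G"
  shows "(\<Sum>w | laplace_matrix G \<alpha> c v w \<noteq> 0. cmod (laplace_matrix G \<alpha> c v w))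
           \<le> (\<Sum>e\<in>edges_at G v. cmod (\<alpha> v e)) + cmod c"
proof -
  define S where "S = insert v (other_end G v ` edges_at G v)"
  have fin: "finite (edges_at G v)" "finite S"
    using finite_edges_at[OF G] by (auto simp: S_def)
  have "(\<Sum>w | laplace_matrix G \<alpha> c v w \<noteq> 0. cmod (laplace_matrix G \<alpha> c v w))
      = (\<Sum>w\<in>S. cmod (laplace_matrix G \<alpha> c v w))"
    using laplace_matrix_row[of v] fin(2) unfolding S_def
    by (intro sum.mono_neutral_left) auto
  also have "\<dots> \<le> (\<Sum>w\<in>S. (\<Sum>e | e \<in> edges_at G v \<and> other_end G v e = w. cmod (\<alpha> v e))
                      + (if w = v then cmod c else 0))"
  proof (rule sum_mono)
    fix w
    have "cmod (laplace_matrix G \<alpha> c v w) \<le> cmod (\<Sum>e | e \<in> edges G \<and> ends G e = {v, w}. \<alpha> v e)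
        + cmod (if v = w \<and> v \<in> verts G then c else 0)"
      unfolding laplace_matrix_def by (rule norm_triangle_ineq4)
    also have "cmod (\<Sum>e | e \<in> edges G \<and> ends G e = {v, w}. \<alpha> v e)
        \<le> (\<Sum>e | e \<in> edges_at G v \<and> other_end G v e = w. cmod (\<alpha> v e))"
      unfolding edges_at_other_end_eq[OF G] by (rule norm_sum)
    finally show "cmod (laplace_matrix G \<alpha> c v w)
        \<le> (\<Sum>e | e \<in> edges_at G v \<and> other_end G v e = w. cmod (\<alpha> v e)) + (if w = v then cmod c else 0)"
      using assms by (auto split: if_splits)
  qed
  also have "\<dots> = (\<Sum>w\<in>S. \<Sum>e | e \<in> edges_at G v \<and> other_end G v e = w. cmod (\<alpha> v e)) + cmod c"
    using fin by (simp add: sum.distrib S_def)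
  also have "(\<Sum>w\<in>S. \<Sum>e | e \<in> edges_at G v \<and> other_end G v e = w. cmod (\<alpha> v e))
      = (\<Sum>e\<in>edges_at G v. cmod (\<alpha> v e))"
    using fin by (intro sum.group) (auto simp: S_def)
  finally show ?thesis .
qed

lemma laplace_matrix_row_sum_le:
  assumes deg: "\<And>v. v \<in> verts G \<Longrightarrow> card (edges_at G v) \<le> D"
    and M: "0 \<le> M" "\<And>v e. e \<in> edges_at G v \<Longrightarrow> cmod (\<alpha> v e) \<le> M"
  shows "(\<Sum>w | laplace_matrix G \<alpha> c v w \<noteq> 0. cmod (laplace_matrix G \<alpha> c v w)) \<le> real D * M + cmod c + 1"
proof (cases "v \<in> verts G")
  case True
  have "(\<Sum>e\<in>edges_at G v. cmod (\<alpha> v e)) \<le> real (card (edges_at G v)) * M"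
    using M by (intro sum_bounded_above) auto
  also have "\<dots> \<le> real D * M"
    using deg[OF True] M(1) by (intro mult_right_mono) auto
  finally show ?thesis
    using laplace_matrix_row_sum[OF True] by linarith
next
  case False
  then have "{w. laplace_matrix G \<alpha> c v w \<noteq> 0} = {}"
    using laplace_matrix_entries by blast
  moreover have "0 \<le> real D * M" using M(1) by simp
  ultimately show ?thesis by (simp only: sum.empty) simp
qed

end

lemma locally_finite_laplace_matrix:
  assumes G: "is_mgraph G"
    and deg: "\<And>v. v \<in> verts G \<Longrightarrow> card (edges_at G v) \<le> D"
    and M: "0 \<le> M" "\<And>v e. e \<in> edges_at G v \<Longrightarrow> cmod (\<alpha> v e) \<le> M"
  shows "locally_finite_matrix (verts G) (laplace_matrix G \<alpha> c) (real D * M + cmod c + 1)"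
proof
  have row: "finite {w. laplace_matrix G \<beta> d v w \<noteq> 0}" for \<beta> d v
    using laplace_matrix_row[OF G] finite_edges_at[OF G] by (meson finite.insertI finite_imageI finite_subset)
  have column: "laplace_matrix G \<alpha> c v w = cnj (laplace_matrix G (adjoint_weight G \<alpha>) (cnj c) w v)" for v w
    by (simp add: conj_transpose_laplace_matrix[symmetric] conj_transpose_def)
  have M': "cmod (adjoint_weight G \<alpha> v e) \<le> M" if "e \<in> edges_at G v" for v e
    using M(2) edge_endpoints(4)[OF G that] by (simp add: adjoint_weight_def)
  fix v w
  show "laplace_matrix G \<alpha> c v w \<noteq> 0 \<Longrightarrow> v \<in> verts G \<and> w \<in> verts G"
    by (rule laplace_matrix_entries[OF G])
  show "finite {w. laplace_matrix G \<alpha> c v w \<noteq> 0}"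
    by (rule row)
  show "finite {v. laplace_matrix G \<alpha> c v w \<noteq> 0}"
    unfolding column using row by simp
  show "(\<Sum>w | laplace_matrix G \<alpha> c v w \<noteq> 0. cmod (laplace_matrix G \<alpha> c v w)) \<le> real D * M + cmod c + 1"
    by (rule laplace_matrix_row_sum_le[OF G deg M])
  show "(\<Sum>v | laplace_matrix G \<alpha> c v w \<noteq> 0. cmod (laplace_matrix G \<alpha> c v w)) \<le> real D * M + cmod c + 1"
    unfolding column using laplace_matrix_row_sum_le[OF G deg M(1) M', where c = "cnj c" and v = w] by simp
  show "1 \<le> real D * M + cmod c + 1"
    using M(1) by simp
qed


section \<open>Coverings and transport along edges\<close>

locale graph_covering =
  fixes G1 :: "('v1, 'e1, 'z1) mgraph_scheme" and G2 :: "('v2, 'e2, 'z2) mgraph_scheme"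
    and p :: "'v1 \<Rightarrow> 'v2" and q :: "'e1 \<Rightarrow> 'e2"
  assumes G1: "is_mgraph G1" and G2: "is_mgraph G2" and covering: "covering G1 G2 p q"
begin

definition lift_edge :: "'v1 \<Rightarrow> 'e2 \<Rightarrow> 'e1" where
  "lift_edge y e = inv_into (edges_at G1 y) q e"

text \<open>The bijection between the fibres over the two ends of \<open>e\<close> that the lifts of \<open>e\<close> define. It is its own inverse,
  as \<open>e\<close> has no orientation; if \<open>e\<close> is a loop, it is an involution of one fibre, whether or not the lifts
  are loops.\<close>

definition transport :: "'e2 \<Rightarrow> 'v1 \<Rightarrow> 'v1" where
  "transport e y = other_end G1 y (lift_edge y e)"

definition fibre :: "'v2 \<Rightarrow> 'v1 set" where
  "fibre b = {y \<in> verts G1. p y = b}"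

lemma p_in: "y \<in> verts G1 \<Longrightarrow> p y \<in> verts G2"
  using covering by (auto simp: covering_def)

lemma fibre_nonempty:
  assumes "b \<in> verts G2"
  obtains y where "y \<in> verts G1" "p y = b"
proof -
  have "b \<in> p ` verts G1"
    using covering assms by (simp add: covering_def)
  then show thesis
    using that by blast
qed

lemma q_bij: "y \<in> verts G1 \<Longrightarrow> bij_betw q (edges_at G1 y) (edges_at G2 (p y))"
  using covering by (auto simp: covering_def)

lemma lift_edge:
  assumes "y \<in> verts G1" "e \<in> edges_at G2 (p y)"
  shows "lift_edge y e \<in> edges_at G1 y" "q (lift_edge y e) = e"
  using q_bij[OF assms(1)] assms(2) unfolding lift_edge_def
  by (auto simp: bij_betw_def intro: inv_into_into f_inv_into_f)

lemma lift_edge_q: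
  assumes "y \<in> verts G1" "e \<in> edges_at G1 y"
  shows "lift_edge y (q e) = e"
  using q_bij[OF assms(1)] assms(2) by (simp add: lift_edge_def bij_betw_def)

lemma transport:
  assumes y: "y \<in> verts G1" and e: "e \<in> edges_at G2 (p y)"
  shows "transport e y \<in> verts G1" "p (transport e y) = other_end G2 (p y) e"
    "transport e (transport e y) = y" "(y, transport e y) \<in> adj G1" "e \<in> edges_at G2 (p (transport e y))"
proof -
  let ?e = "lift_edge y e"
  note l = lift_edge[OF assms]
  show 1: "transport e y \<in> verts G1"
    unfolding transport_def by (rule edge_endpoints(2)[OF G1 l(1)])
  show 2: "p (transport e y) = other_end G2 (p y) e"
    using covering y l by (auto simp: covering_def transport_def)
  have "?e \<in> edges_at G1 (transport e y)"
    using edge_endpoints(4)[OF G1 l(1)] by (simp add: transport_def)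
  then have "lift_edge (transport e y) e = ?e"
    using lift_edge_q[OF 1, of ?e] l(2) by simp
  then show "transport e (transport e y) = y"
    using edge_endpoints(5)[OF G1 l(1)] by (simp add: transport_def[of e "transport e y"]) (simp add: transport_def)
  show "(y, transport e y) \<in> adj G1"
    using edge_endpoints(3)[OF G1 l(1)] l(1) by (auto simp: adj_def transport_def edges_at_def)
  show "e \<in> edges_at G2 (p (transport e y))"
    using edge_endpoints(4)[OF G2 e] 2 by simp
qed

lemma transport_fibre:
  assumes "e \<in> edges_at G2 b" "y \<in> fibre b"
  shows "transport e y \<in> fibre (other_end G2 b e)" "transport e (transport e y) = y"
  using transport[of y e] assms by (auto simp: fibre_def)

lemma inj_on_transport:
  assumes "e \<in> edges_at G2 b" "Y \<subseteq> fibre b"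
  shows "inj_on (transport e) Y"
  using transport_fibre(2)[OF assms(1)] assms(2) by (metis inj_on_inverseI subsetD)

lemma sum_edges_at_transport:
  assumes y: "y \<in> verts G1" and \<alpha>: "\<And>e. e \<in> edges_at G1 y \<Longrightarrow> \<alpha>1 y e = \<alpha>2 (p y) (q e)"
  shows "(\<Sum>e\<in>edges_at G1 y. \<alpha>1 y e * h (other_end G1 y e))
       = (\<Sum>e\<in>edges_at G2 (p y). \<alpha>2 (p y) e * h (transport e y))"
proof -
  have "(\<Sum>e\<in>edges_at G1 y. \<alpha>1 y e * h (other_end G1 y e))
      = (\<Sum>e\<in>edges_at G1 y. \<alpha>2 (p y) (q e) * h (transport (q e) y))"
    using y by (intro sum.cong) (auto simp: \<alpha> transport_def lift_edge_q)
  also have "\<dots> = (\<Sum>e\<in>edges_at G2 (p y). \<alpha>2 (p y) e * h (transport e y))"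
    by (rule sum.reindex_bij_betw[OF q_bij[OF y]])
  finally show ?thesis .
qed

section \<open>Almost invariant cut-off functions\<close>

text \<open>Restricted to the support of \<open>\<omega>\<close>, since fibres may be infinite and \<open>L2_set\<close> is \<open>0\<close> on infinite sets.\<close>

definition fibre_norm :: "('v1 \<Rightarrow> real) \<Rightarrow> 'v2 \<Rightarrow> real" where
  "fibre_norm \<omega> b = L2_set \<omega> {y \<in> fibre b. \<omega> y \<noteq> 0}"

text \<open>Cut-off functions that, on each fibre over \<open>A\<close>, are moved little by transport relative to their norm on that
  fibre. Comparing with the norm on the single fibre, and not with the total norm, is what makes lifting possible
  for arbitrary functions supported in \<open>A\<close>.\<close>

definition almost_invariant :: "'v2 set \<Rightarrow> real \<Rightarrow> ('v1 \<Rightarrow> real) \<Rightarrow> bool" where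
  "almost_invariant A \<eta> \<omega> \<longleftrightarrow>
     finite {y. \<omega> y \<noteq> 0} \<and> {y. \<omega> y \<noteq> 0} \<subseteq> verts G1 \<and>
     (\<forall>b\<in>A. 0 < fibre_norm \<omega> b \<and>
        (\<forall>e\<in>edges_at G2 b. \<forall>Y. finite Y \<and> Y \<subseteq> fibre b \<longrightarrow>
           L2_set (\<lambda>y. \<omega> (transport e y) - \<omega> y) Y \<le> \<eta> * fibre_norm \<omega> b))"

lemma L2_set_subset_fibre:
  assumes "finite {y. \<omega> y \<noteq> 0}" "Y \<subseteq> fibre b" "finite Y"
  shows "L2_set \<omega> Y \<le> fibre_norm \<omega> b"
    and "{y \<in> fibre b. \<omega> y \<noteq> 0} \<subseteq> Y \<Longrightarrow> L2_set \<omega> Y = fibre_norm \<omega> b"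
proof -
  have fin: "finite {y \<in> fibre b. \<omega> y \<noteq> 0}"
    using assms(1) by simp
  have "(\<Sum>y\<in>Y. (\<omega> y)\<^sup>2) = (\<Sum>y\<in>Y \<inter> {y. \<omega> y \<noteq> 0}. (\<omega> y)\<^sup>2)"
    using assms by (intro sum.mono_neutral_right) auto
  also have "\<dots> \<le> (\<Sum>y\<in>{y \<in> fibre b. \<omega> y \<noteq> 0}. (\<omega> y)\<^sup>2)"
    using assms fin by (intro sum_mono2) auto
  finally show "L2_set \<omega> Y \<le> fibre_norm \<omega> b"
    by (simp add: L2_set_def fibre_norm_def)
  assume sup: "{y \<in> fibre b. \<omega> y \<noteq> 0} \<subseteq> Y"
  have "(\<Sum>y\<in>Y. (\<omega> y)\<^sup>2) = (\<Sum>y\<in>{y \<in> fibre b. \<omega> y \<noteq> 0}. (\<omega> y)\<^sup>2)"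
    using assms sup by (intro sum.mono_neutral_right) auto
  then show "L2_set \<omega> Y = fibre_norm \<omega> b"
    by (simp add: L2_set_def fibre_norm_def)
qed

context
  fixes A \<eta> \<omega>
  assumes inv: "almost_invariant A \<eta> \<omega>"
begin

lemma finite_support: "finite {y. \<omega> y \<noteq> 0}"
  using inv by (simp add: almost_invariant_def)

text \<open>Transport along \<open>e\<close> turns a difference on the fibre over one end into a difference on the fibre over the other
  end, so the norm of either fibre may appear on the right.\<close>

lemma almost_invariant_reverse:
  assumes e: "e \<in> edges_at G2 b" "other_end G2 b e \<in> A" and Y: "finite Y" "Y \<subseteq> fibre b"
  shows "L2_set (\<lambda>y. \<omega> (transport e y) - \<omega> y) Y \<le> \<eta> * fibre_norm \<omega> (other_end G2 b e)"
proof -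
  have "L2_set (\<lambda>y. \<omega> (transport e y) - \<omega> y) Y
      = L2_set (\<lambda>y. \<omega> (transport e y) - \<omega> y) (transport e ` Y)"
  proof -
    have "(\<Sum>y\<in>transport e ` Y. (\<omega> (transport e y) - \<omega> y)\<^sup>2)
        = (\<Sum>y\<in>Y. (\<omega> (transport e (transport e y)) - \<omega> (transport e y))\<^sup>2)"
      by (simp add: sum.reindex[OF inj_on_transport[OF e(1) Y(2)]])
    also have "\<dots> = (\<Sum>y\<in>Y. (\<omega> (transport e y) - \<omega> y)\<^sup>2)"
      using transport_fibre(2)[OF e(1)] Y(2) by (intro sum.cong) (auto simp: power2_commute)
    finally show ?thesis by (simp add: L2_set_def)
  qed
  also have "\<dots> \<le> \<eta> * fibre_norm \<omega> (other_end G2 b e)"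
  proof -
    have "transport e ` Y \<subseteq> fibre (other_end G2 b e)"
      using transport_fibre(1)[OF e(1)] Y(2) by blast
    then show ?thesis
      using inv e(2) Y(1) edge_endpoints(4)[OF G2 e(1)] unfolding almost_invariant_def by blast
  qed
  finally show ?thesis .
qed

text \<open>Transport preserves \<open>l2\<close> norms, so the fibre norms at the ends of \<open>e\<close> are the norms of \<open>\<omega> \<circ> transport e\<close> and \<open>\<omega>\<close>
  on one and the same fibre, and the triangle inequality applies.\<close>

lemma fibre_norm_diff:
  assumes e: "e \<in> edges_at G2 b" "other_end G2 b e \<in> A"
  shows "\<bar>fibre_norm \<omega> (other_end G2 b e) - fibre_norm \<omega> b\<bar> \<le> \<eta> * fibre_norm \<omega> (other_end G2 b e)"
proof -
  define b' where "b' = other_end G2 b e"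
  have e': "e \<in> edges_at G2 b'" "other_end G2 b' e = b"
    using edge_endpoints(4,5)[OF G2 e(1)] by (auto simp: b'_def)
  define W where "W b = {y \<in> fibre b. \<omega> y \<noteq> 0}" for b
  define Y where "Y = W b \<union> transport e ` W b'"
  have Y: "finite Y" "Y \<subseteq> fibre b"
    using finite_support transport_fibre(1)[OF e'(1)] e'(2) by (auto simp: Y_def W_def)
  have 1: "L2_set \<omega> Y = fibre_norm \<omega> b"
    using finite_support Y by (intro L2_set_subset_fibre(2)) (auto simp: Y_def W_def)
  have sub: "transport e ` Y \<subseteq> fibre b'"
    using transport_fibre(1)[OF e(1)] Y(2) by (auto simp: b'_def)
  have "W b' \<subseteq> transport e ` Y"
  proof
    fix y assume "y \<in> W b'"
    then show "y \<in> transport e ` Y"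
      using transport_fibre(2)[OF e'(1), of y] by (intro image_eqI[of _ _ "transport e y"]) (auto simp: W_def Y_def)
  qed
  then have "L2_set \<omega> (transport e ` Y) = fibre_norm \<omega> b'"
    using finite_support Y sub by (intro L2_set_subset_fibre(2)) (auto simp: W_def)
  then have 2: "L2_set (\<lambda>y. \<omega> (transport e y)) Y = fibre_norm \<omega> b'"
    by (simp add: L2_set_def sum.reindex[OF inj_on_transport[OF e(1) Y(2)]])
  have 3: "L2_set (\<lambda>y. \<omega> (transport e y) - \<omega> y) Y \<le> \<eta> * fibre_norm \<omega> b'"
    unfolding b'_def by (rule almost_invariant_reverse[OF e Y])
  have "L2_set (\<lambda>y. \<omega> (transport e y)) Y \<le> L2_set \<omega> Y + L2_set (\<lambda>y. \<omega> (transport e y) - \<omega> y) Y"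
    using L2_set_triangle_ineq[of \<omega> "\<lambda>y. \<omega> (transport e y) - \<omega> y" Y] by simp
  then have "fibre_norm \<omega> b' \<le> fibre_norm \<omega> b + \<eta> * fibre_norm \<omega> b'"
    using 3 unfolding 1 2 by linarith
  moreover have "L2_set \<omega> Y \<le> L2_set (\<lambda>y. \<omega> (transport e y)) Y + L2_set (\<lambda>y. \<omega> y - \<omega> (transport e y)) Y"
    using L2_set_triangle_ineq[of "\<lambda>y. \<omega> (transport e y)" "\<lambda>y. \<omega> y - \<omega> (transport e y)" Y] by simp
  moreover have "L2_set (\<lambda>y. \<omega> y - \<omega> (transport e y)) Y = L2_set (\<lambda>y. \<omega> (transport e y) - \<omega> y) Y"
    unfolding L2_set_def by (simp only: power2_commute)
  ultimately have "fibre_norm \<omega> b' \<le> fibre_norm \<omega> b + \<eta> * fibre_norm \<omega> b'"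
    "fibre_norm \<omega> b \<le> fibre_norm \<omega> b' + \<eta> * fibre_norm \<omega> b'"
    using 3 unfolding 1 2 by linarith+
  then show ?thesis
    unfolding b'_def by linarith
qed

text \<open>Replacing one of the two normalizations by the other costs \<open>\<eta>\<close>, by \<open>fibre_norm_diff\<close>, and the difference
  with a common normalization costs another \<open>\<eta>\<close>.\<close>

lemma normalized_almost_invariant:
  assumes e: "e \<in> edges_at G2 b" "other_end G2 b e \<in> A" "b \<in> A" and Y: "finite Y" "Y \<subseteq> fibre b"
  shows "L2_set (\<lambda>y. \<omega> (transport e y) / fibre_norm \<omega> (other_end G2 b e) - \<omega> y / fibre_norm \<omega> b) Y \<le> 2 * \<eta>"
proof -
  define N where "N = fibre_norm \<omega> b"
  define N' where "N' = fibre_norm \<omega> (other_end G2 b e)"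
  have N: "0 < N" "0 < N'"
    using inv e by (auto simp: N_def N'_def almost_invariant_def)
  have "(\<lambda>y. \<omega> (transport e y) / N' - \<omega> y / N)
      = (\<lambda>y. (1 / N') * (\<omega> (transport e y) - \<omega> y) + (1 / N' - 1 / N) * \<omega> y)"
    by (simp add: algebra_simps)
  then have "L2_set (\<lambda>y. \<omega> (transport e y) / N' - \<omega> y / N) Y
      \<le> L2_set (\<lambda>y. (1 / N') * (\<omega> (transport e y) - \<omega> y)) Y + L2_set (\<lambda>y. (1 / N' - 1 / N) * \<omega> y) Y"
    by (simp only: L2_set_triangle_ineq)
  moreover have "L2_set (\<lambda>y. (1 / N') * (\<omega> (transport e y) - \<omega> y)) Y \<le> \<eta>"
  proof -
    have "L2_set (\<lambda>y. (1 / N') * (\<omega> (transport e y) - \<omega> y)) Y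
        = (1 / N') * L2_set (\<lambda>y. \<omega> (transport e y) - \<omega> y) Y"
      using N by (intro L2_set_right_distrib[symmetric]) auto
    also have "\<dots> \<le> (1 / N') * (\<eta> * N')"
      using N almost_invariant_reverse[OF e(1,2) Y] by (intro mult_left_mono) (auto simp: N'_def)
    finally show ?thesis using N by simp
  qed
  moreover have "L2_set (\<lambda>y. (1 / N' - 1 / N) * \<omega> y) Y \<le> \<eta>"
  proof -
    have "L2_set (\<lambda>y. (1 / N' - 1 / N) * \<omega> y) Y = \<bar>1 / N' - 1 / N\<bar> * L2_set \<omega> Y"
      by (simp add: L2_set_def power_mult_distrib real_sqrt_mult flip: sum_distrib_left)
    also have "\<dots> \<le> \<bar>1 / N' - 1 / N\<bar> * N"
      using L2_set_subset_fibre(1)[OF finite_support Y(2,1)] by (intro mult_left_mono) (auto simp: N_def)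
    also have "\<dots> = \<bar>(1 / N' - 1 / N) * N\<bar>"
      using N by (simp add: abs_mult)
    also have "(1 / N' - 1 / N) * N = - ((N' - N) / N')"
      using N by (simp add: field_simps)
    also have "\<bar>- ((N' - N) / N')\<bar> = \<bar>N' - N\<bar> / N'"
      using N by (simp add: abs_divide)
    also have "\<dots> \<le> \<eta>"
      using N fibre_norm_diff[OF e(1,2)] by (simp add: field_simps N_def N'_def)
    finally show ?thesis .
  qed
  ultimately show ?thesis
    unfolding N_def N'_def by linarith
qed

text \<open>An inequality only, because \<open>Y\<close> may miss a part of the support of \<open>\<omega>\<close> in a fibre, or the fibre norm may be \<open>0\<close>.\<close>

lemma L2_set_lift_le:
  assumes Y: "finite Y" "Y \<subseteq> verts G1"
  shows "L2_set (\<lambda>y. cmod (of_real (\<omega> y / fibre_norm \<omega> (p y)) * g (p y))) Y \<le> L2_set (\<lambda>b. cmod (g b)) (p ` Y)"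
proof -
  have "(\<Sum>y\<in>Y. (\<omega> y / fibre_norm \<omega> (p y) * cmod (g (p y)))\<^sup>2)
      = (\<Sum>b\<in>p ` Y. \<Sum>y | y \<in> Y \<and> p y = b. (\<omega> y / fibre_norm \<omega> (p y) * cmod (g (p y)))\<^sup>2)"
    by (rule sum.image_gen[OF Y(1)])
  also have "\<dots> \<le> (\<Sum>b\<in>p ` Y. (cmod (g b))\<^sup>2)"
  proof (rule sum_mono)
    fix b
    define N where "N = fibre_norm \<omega> b"
    have "L2_set \<omega> {y \<in> Y. p y = b} \<le> N"
      unfolding N_def using Y by (intro L2_set_subset_fibre(1) finite_support) (auto simp: fibre_def)
    then have "(L2_set \<omega> {y \<in> Y. p y = b})\<^sup>2 \<le> N\<^sup>2"
      by (intro power_mono) auto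
    then have le: "(\<Sum>y | y \<in> Y \<and> p y = b. (\<omega> y)\<^sup>2) \<le> N\<^sup>2"
      by (simp add: L2_set_def sum_nonneg)
    have "(\<Sum>y | y \<in> Y \<and> p y = b. (\<omega> y / fibre_norm \<omega> (p y) * cmod (g (p y)))\<^sup>2)
        = (\<Sum>y | y \<in> Y \<and> p y = b. (\<omega> y)\<^sup>2) / N\<^sup>2 * (cmod (g b))\<^sup>2"
      by (simp add: N_def power_mult_distrib power_divide sum_divide_distrib sum_distrib_right cong: conj_cong)
    also have "\<dots> \<le> 1 * (cmod (g b))\<^sup>2"
      using le by (intro mult_right_mono) (auto simp: divide_le_eq_1)
    finally show "(\<Sum>y | y \<in> Y \<and> p y = b. (\<omega> y / fibre_norm \<omega> (p y) * cmod (g (p y)))\<^sup>2) \<le> (cmod (g b))\<^sup>2"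
      by simp
  qed
  finally show ?thesis
    by (simp add: L2_set_def norm_mult norm_divide power_mult_distrib power_divide)
qed

lemma l2_norm_lift:
  assumes f: "fin_supp (verts G2) f" and A: "{b. f b \<noteq> 0} \<subseteq> A"
  defines "h \<equiv> \<lambda>y. of_real (\<omega> y / fibre_norm \<omega> (p y)) * f (p y)"
  shows "fin_supp (verts G1) h" and "l2_norm (verts G2) f = l2_norm (verts G1) h"
proof -
  have sub: "{y. h y \<noteq> 0} \<subseteq> {y. \<omega> y \<noteq> 0}"
    by (auto simp: h_def)
  then show h: "fin_supp (verts G1) h"
    using inv finite_subset[OF sub finite_support] by (auto simp: fin_supp_def almost_invariant_def)
  define A0 where "A0 = {b. f b \<noteq> 0}"
  have A0: "finite A0" "A0 \<subseteq> verts G2" "\<And>b. b \<notin> A0 \<Longrightarrow> f b = 0"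
    using f by (auto simp: A0_def fin_supp_def)
  define Y where "Y = {y. \<omega> y \<noteq> 0 \<and> p y \<in> A0}"
  have Y: "finite Y" "Y \<subseteq> verts G1" "\<And>y. y \<notin> Y \<Longrightarrow> h y = 0"
    using finite_support inv A0(3) by (auto simp: Y_def h_def almost_invariant_def)
  have fib: "{y \<in> Y. p y = b} = {y \<in> fibre b. \<omega> y \<noteq> 0}" if "b \<in> A0" for b
    using that inv by (auto simp: Y_def fibre_def almost_invariant_def)
  have "(\<Sum>y\<in>Y. (cmod (h y))\<^sup>2) = (\<Sum>b\<in>A0. \<Sum>y | y \<in> Y \<and> p y = b. (cmod (h y))\<^sup>2)"
    using Y A0 by (intro sum.group[symmetric]) (auto simp: Y_def)
  also have "\<dots> = (\<Sum>b\<in>A0. (cmod (f b))\<^sup>2)"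
  proof (rule sum.cong[OF refl])
    fix b assume b: "b \<in> A0"
    define N where "N = fibre_norm \<omega> b"
    have "0 < N"
      using b A inv by (auto simp: N_def A0_def almost_invariant_def)
    have "(\<Sum>y | y \<in> Y \<and> p y = b. (\<omega> y)\<^sup>2) = N\<^sup>2"
      unfolding fib[OF b] N_def fibre_norm_def by (simp add: L2_set_def sum_nonneg)
    moreover have "(\<Sum>y | y \<in> Y \<and> p y = b. (cmod (h y))\<^sup>2)
        = (\<Sum>y | y \<in> Y \<and> p y = b. (\<omega> y)\<^sup>2) / N\<^sup>2 * (cmod (f b))\<^sup>2"
      by (simp add: N_def h_def norm_mult norm_divide power_mult_distrib power_divide sum_divide_distrib
          sum_distrib_right cong: conj_cong)
    ultimately show "(\<Sum>y | y \<in> Y \<and> p y = b. (cmod (h y))\<^sup>2) = (cmod (f b))\<^sup>2"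
      using \<open>0 < N\<close> by simp
  qed
  finally show "l2_norm (verts G2) f = l2_norm (verts G1) h"
    by (simp add: l2_norm_eq_L2_set(2)[OF A0] l2_norm_eq_L2_set(2)[OF Y] L2_set_def)
qed

end


section \<open>Lower bounds pass down a covering\<close>

text \<open>The diagonal terms \<open>c\<close> cancel in the difference of \<open>T1 h\<close> and the lift of \<open>T2 f\<close>. On the fibre over \<open>b\<close> there remains,
  for each edge \<open>e\<close> at \<open>b\<close>, a weight times \<open>f (other_end G2 b e)\<close> times a function of norm at most \<open>2 \<eta>\<close>, by
  \<open>normalized_almost_invariant\<close>. The sum over \<open>b\<close> is then controlled by the unweighted
  adjacency operator of \<open>\<Gamma>2\<close> applied to \<open>|f|\<close>, which is bounded by the Schur test.\<close>

lemma laplace_matrix_lift: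
  assumes \<alpha>: "\<And>y e. y \<in> verts G1 \<Longrightarrow> e \<in> edges_at G1 y \<Longrightarrow> \<alpha>1 y e = \<alpha>2 (p y) (q e)"
    and deg: "\<And>b. b \<in> verts G2 \<Longrightarrow> card (edges_at G2 b) \<le> D"
    and M: "0 \<le> M" "\<And>b e. e \<in> edges_at G2 b \<Longrightarrow> cmod (\<alpha>2 b e) \<le> M"
    and f: "fin_supp (verts G2) f"
    and A: "\<And>b. f b \<noteq> 0 \<Longrightarrow> b \<in> A"
      "\<And>b e. e \<in> edges_at G2 b \<Longrightarrow> f (other_end G2 b e) \<noteq> 0 \<Longrightarrow> b \<in> A"
    and inv: "almost_invariant A \<eta> \<omega>" and \<eta>: "0 < \<eta>"
  defines "\<rho> \<equiv> \<lambda>y. \<omega> y / fibre_norm \<omega> (p y)"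
  shows "l2_norm (verts G1) (mat_op (laplace_matrix G1 \<alpha>1 c) (\<lambda>y. of_real (\<rho> y) * f (p y)))
           \<le> l2_norm (verts G2) (mat_op (laplace_matrix G2 \<alpha>2 c) f)
             + 2 * \<eta> * M * (real D + 1) * l2_norm (verts G2) f"
proof -
  define h where "h y = of_real (\<rho> y) * f (p y)" for y
  define T1h where "T1h = mat_op (laplace_matrix G1 \<alpha>1 c) h"
  define T2f where "T2f = mat_op (laplace_matrix G2 \<alpha>2 c) f"
  define err where "err y = (\<Sum>e\<in>edges_at G2 (p y). \<alpha>2 (p y) e
      * of_real (\<rho> (transport e y) - \<rho> y) * f (other_end G2 (p y) e))" for y
  define u where "u b = (\<Sum>e\<in>edges_at G2 b. cmod (f (other_end G2 b e)))" for b
  interpret T2: locally_finite_matrix "verts G2" "laplace_matrix G2 \<alpha>2 c" "real D * M + cmod c + 1"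
    by (rule locally_finite_laplace_matrix[OF G2 deg M])
  have T2f_l2: "T2f \<in> l2 (verts G2)"
    unfolding T2f_def by (intro T2.mat_op_bounded(1) fin_supp_l2 f)
  have decomp: "T1h y = err y + of_real (\<rho> y) * T2f (p y)" if y: "y \<in> verts G1" for y
  proof -
    have "T1h y = (\<Sum>e\<in>edges_at G2 (p y). \<alpha>2 (p y) e * h (transport e y)) - c * h y"
      unfolding T1h_def mat_op_laplace_matrix[OF G1 y]
      using sum_edges_at_transport[OF y, of \<alpha>1 \<alpha>2 h] \<alpha>[OF y] by simp
    also have "\<dots> = (\<Sum>e\<in>edges_at G2 (p y). \<alpha>2 (p y) e * of_real (\<rho> (transport e y)) * f (other_end G2 (p y) e))
        - of_real (\<rho> y) * c * f (p y)"
      using transport(2)[OF y] by (simp add: h_def mult_ac)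
    also have "\<dots> = err y + of_real (\<rho> y) * T2f (p y)"
      unfolding T2f_def err_def mat_op_laplace_matrix[OF G2 p_in[OF y]]
      by (simp add: algebra_simps sum_distrib_left sum_subtractf)
    finally show ?thesis .
  qed
  have u_bound: "L2_set u B \<le> (real D + 1) * l2_norm (verts G2) f" if B: "finite B" "B \<subseteq> verts G2" for B
  proof -
    \<comment> \<open>the adjacency operator: all weights \<open>1\<close> and no diagonal term\<close>
    interpret N: locally_finite_matrix "verts G2" "laplace_matrix G2 (\<lambda>_ _. 1) 0" "real D * 1 + cmod 0 + 1"
      by (rule locally_finite_laplace_matrix[OF G2 deg]) auto
    let ?F = "\<lambda>b. complex_of_real (cmod (f b))"
    define S where "S = {b. f b \<noteq> 0}"
    have S: "finite S" "S \<subseteq> verts G2" "\<And>b. b \<notin> S \<Longrightarrow> f b = 0" "\<And>b. b \<notin> S \<Longrightarrow> ?F b = 0"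
      using f by (auto simp: S_def fin_supp_def)
    have F: "?F \<in> l2 (verts G2)" "l2_norm (verts G2) ?F = l2_norm (verts G2) f"
      using l2_norm_eq_L2_set[OF S(1,2,4)] l2_norm_eq_L2_set(2)[OF S(1-3)] by simp_all
    have "L2_set u B = L2_set (\<lambda>b. cmod (mat_op (laplace_matrix G2 (\<lambda>_ _. 1) 0) ?F b)) B"
    proof (rule L2_set_cong[OF refl])
      fix b assume "b \<in> B"
      then have "mat_op (laplace_matrix G2 (\<lambda>_ _. 1) 0) ?F b = of_real (u b)"
        using B(2) by (simp add: mat_op_laplace_matrix[OF G2] u_def subset_iff)
      moreover have "0 \<le> u b"
        by (simp add: u_def sum_nonneg)
      ultimately show "u b = cmod (mat_op (laplace_matrix G2 (\<lambda>_ _. 1) 0) ?F b)"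
        by simp
    qed
    also have "\<dots> \<le> l2_norm (verts G2) (mat_op (laplace_matrix G2 (\<lambda>_ _. 1) 0) ?F)"
      by (intro L2_set_le_l2_norm N.mat_op_bounded(1) F B)
    also have "\<dots> \<le> (real D + 1) * l2_norm (verts G2) f"
      using N.mat_op_bounded(2)[OF F(1)] F(2) by simp
    finally show ?thesis .
  qed
  have err_fibre: "L2_set (\<lambda>y. cmod (err y)) Y \<le> 2 * \<eta> * M * u b" if Y: "finite Y" "Y \<subseteq> fibre b" for Y b
  proof -
    let ?g = "\<lambda>e y. M * cmod (f (other_end G2 b e)) * \<bar>\<rho> (transport e y) - \<rho> y\<bar>"
    have "L2_set (\<lambda>y. cmod (err y)) Y \<le> L2_set (\<lambda>y. \<Sum>e\<in>edges_at G2 b. ?g e y) Y"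
    proof (rule L2_set_mono)
      fix y assume "y \<in> Y"
      then have "p y = b" using Y(2) by (auto simp: fibre_def)
      have "cmod (err y) \<le> (\<Sum>e\<in>edges_at G2 b. cmod (\<alpha>2 b e) * \<bar>\<rho> (transport e y) - \<rho> y\<bar> * cmod (f (other_end G2 b e)))"
        unfolding err_def \<open>p y = b\<close> by (rule sum_norm_le) (simp add: norm_mult del: of_real_diff)
      also have "\<dots> \<le> (\<Sum>e\<in>edges_at G2 b. M * \<bar>\<rho> (transport e y) - \<rho> y\<bar> * cmod (f (other_end G2 b e)))"
        using M(2) by (intro sum_mono mult_right_mono) auto
      finally show "cmod (err y) \<le> (\<Sum>e\<in>edges_at G2 b. ?g e y)"
        by (simp add: mult_ac)
    qed auto
    also have "\<dots> \<le> (\<Sum>e\<in>edges_at G2 b. L2_set (?g e) Y)"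
      by (rule L2_set_sum_le)
    also have "\<dots> \<le> (\<Sum>e\<in>edges_at G2 b. M * cmod (f (other_end G2 b e)) * (2 * \<eta>))"
    proof (rule sum_mono)
      fix e assume e: "e \<in> edges_at G2 b"
      have "L2_set (?g e) Y = M * cmod (f (other_end G2 b e)) * L2_set (\<lambda>y. \<bar>\<rho> (transport e y) - \<rho> y\<bar>) Y"
        using M(1) by (intro L2_set_right_distrib[symmetric]) simp
      also have "\<dots> \<le> M * cmod (f (other_end G2 b e)) * (2 * \<eta>)"
      proof (cases "f (other_end G2 b e) = 0")
        case False
        have "L2_set (\<lambda>y. \<bar>\<rho> (transport e y) - \<rho> y\<bar>) Y
            = L2_set (\<lambda>y. \<omega> (transport e y) / fibre_norm \<omega> (other_end G2 b e) - \<omega> y / fibre_norm \<omega> b) Y"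
          using Y(2) e transport(2)[of _ e] unfolding L2_set_def
          by (intro arg_cong[of _ _ sqrt] sum.cong) (auto simp: \<rho>_def fibre_def)
        also have "\<dots> \<le> 2 * \<eta>"
          using A e False by (intro normalized_almost_invariant[OF inv] Y) auto
        finally show ?thesis
          using M(1) by (intro mult_left_mono) auto
      qed simp
      finally show "L2_set (?g e) Y \<le> M * cmod (f (other_end G2 b e)) * (2 * \<eta>)" .
    qed
    also have "\<dots> = 2 * \<eta> * M * u b"
      by (simp add: u_def sum_distrib_left mult_ac)
    finally show ?thesis .
  qed
  have err_bound: "L2_set (\<lambda>y. cmod (err y)) Y \<le> 2 * \<eta> * M * (real D + 1) * l2_norm (verts G2) f"
    if Y: "finite Y" "Y \<subseteq> verts G1" for Y
  proof -
    have "(\<Sum>y\<in>Y. (cmod (err y))\<^sup>2) = (\<Sum>b\<in>p ` Y. \<Sum>y | y \<in> Y \<and> p y = b. (cmod (err y))\<^sup>2)"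
      by (rule sum.image_gen[OF Y(1)])
    also have "\<dots> \<le> (\<Sum>b\<in>p ` Y. (2 * \<eta> * M * u b)\<^sup>2)"
    proof (rule sum_mono)
      fix b
      have "L2_set (\<lambda>y. cmod (err y)) {y \<in> Y. p y = b} \<le> 2 * \<eta> * M * u b"
        using Y by (intro err_fibre) (auto simp: fibre_def)
      then have "(L2_set (\<lambda>y. cmod (err y)) {y \<in> Y. p y = b})\<^sup>2 \<le> (2 * \<eta> * M * u b)\<^sup>2"
        by (intro power_mono) auto
      then show "(\<Sum>y | y \<in> Y \<and> p y = b. (cmod (err y))\<^sup>2) \<le> (2 * \<eta> * M * u b)\<^sup>2"
        by (simp add: L2_set_def sum_nonneg)
    qed
    finally have "L2_set (\<lambda>y. cmod (err y)) Y \<le> L2_set (\<lambda>b. 2 * \<eta> * M * u b) (p ` Y)"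
      by (simp add: L2_set_def)
    also have "\<dots> = 2 * \<eta> * M * L2_set u (p ` Y)"
      using \<eta> M(1) by (intro L2_set_right_distrib[symmetric]) simp
    also have "\<dots> \<le> 2 * \<eta> * M * ((real D + 1) * l2_norm (verts G2) f)"
      using \<eta> M(1) Y p_in by (intro mult_left_mono u_bound) auto
    finally show ?thesis
      by (simp add: mult.assoc)
  qed
  have "l2_norm (verts G1) T1h \<le> l2_norm (verts G2) T2f + 2 * \<eta> * M * (real D + 1) * l2_norm (verts G2) f"
  proof (rule l2_normI(2))
    show "T1h y = 0" if "y \<notin> verts G1" for y
    proof -
      have "{w. laplace_matrix G1 \<alpha>1 c y w \<noteq> 0} = {}"
        using laplace_matrix_entries[OF G1] that by blast
      then show ?thesis
        by (simp only: T1h_def mat_op_def sum.empty)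
    qed
    fix Y assume Y: "finite Y" "Y \<subseteq> verts G1"
    have "L2_set (\<lambda>y. cmod (T1h y)) Y \<le> L2_set (\<lambda>y. cmod (err y) + cmod (of_real (\<rho> y) * T2f (p y))) Y"
      using Y decomp by (intro L2_set_mono) (auto simp: subset_iff norm_triangle_ineq)
    also have "\<dots> \<le> L2_set (\<lambda>y. cmod (err y)) Y + L2_set (\<lambda>y. cmod (of_real (\<rho> y) * T2f (p y))) Y"
      by (rule L2_set_triangle_ineq)
    also have "L2_set (\<lambda>y. cmod (of_real (\<rho> y) * T2f (p y))) Y \<le> L2_set (\<lambda>b. cmod (T2f b)) (p ` Y)"
      unfolding \<rho>_def by (rule L2_set_lift_le[OF inv Y])
    also have "\<dots> \<le> l2_norm (verts G2) T2f"
      using Y p_in by (intro L2_set_le_l2_norm T2f_l2) auto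
    finally show "L2_set (\<lambda>y. cmod (T1h y)) Y
        \<le> l2_norm (verts G2) T2f + 2 * \<eta> * M * (real D + 1) * l2_norm (verts G2) f"
      using err_bound[OF Y] by linarith
  qed
  then show ?thesis
    unfolding T1h_def T2f_def h_def[abs_def] .
qed

text \<open>The cut-off must be almost invariant on the support of \<open>f\<close> and its neighbours: over all other
  vertices, both \<open>T1 h\<close> and the lift of \<open>T2 f\<close> vanish.\<close>

theorem bounded_below_covering:
  assumes inv: "\<And>A \<eta>. finite A \<Longrightarrow> A \<subseteq> verts G2 \<Longrightarrow> 0 < \<eta> \<Longrightarrow> \<exists>\<omega>. almost_invariant A \<eta> \<omega>"
    and \<alpha>: "\<And>y e. y \<in> verts G1 \<Longrightarrow> e \<in> edges_at G1 y \<Longrightarrow> \<alpha>1 y e = \<alpha>2 (p y) (q e)"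
    and deg: "\<And>b. b \<in> verts G2 \<Longrightarrow> card (edges_at G2 b) \<le> D"
    and M: "0 \<le> M" "\<And>b e. e \<in> edges_at G2 b \<Longrightarrow> cmod (\<alpha>2 b e) \<le> M"
    and C: "1 \<le> C" "bounded_below (verts G1) C (laplace_matrix G1 \<alpha>1 c)"
  shows "bounded_below (verts G2) C (laplace_matrix G2 \<alpha>2 c)"
  unfolding bounded_below_def
proof (intro allI impI)
  fix f assume f: "fin_supp (verts G2) f"
  define A where "A = {b. f b \<noteq> 0} \<union> (\<Union>b\<in>{b. f b \<noteq> 0}. other_end G2 b ` edges_at G2 b)"
  have A: "finite A" "A \<subseteq> verts G2"
    using f finite_edges_at[OF G2] edge_endpoints(2)[OF G2] by (auto simp: A_def fin_supp_def)
  have A_nbr: "b \<in> A" if "e \<in> edges_at G2 b" "f (other_end G2 b e) \<noteq> 0" for b e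
    using that edge_endpoints(4,5)[OF G2 that(1)] unfolding A_def by force
  define nf where "nf = l2_norm (verts G2) f"
  define L where "L = 2 * C * M * (real D + 1) * nf"
  have "0 \<le> L"
    using C M by (simp add: L_def nf_def l2_norm_nonneg)
  show "nf \<le> C * l2_norm (verts G2) (mat_op (laplace_matrix G2 \<alpha>2 c) f)"
  proof (rule field_le_epsilon)
    fix \<epsilon> :: real assume "0 < \<epsilon>"
    \<comment> \<open>\<open>L + 1\<close> avoids a division by \<open>0\<close> when \<open>f\<close> or the weights vanish\<close>
    define \<eta> where "\<eta> = \<epsilon> / (L + 1)"
    have \<eta>: "0 < \<eta>" "\<eta> * L \<le> \<epsilon>"
      using \<open>0 < \<epsilon>\<close> \<open>0 \<le> L\<close> by (auto simp: \<eta>_def field_simps)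
    obtain \<omega> where \<omega>: "almost_invariant A \<eta> \<omega>"
      using inv[OF A \<eta>(1)] by blast
    let ?h = "\<lambda>y. of_real (\<omega> y / fibre_norm \<omega> (p y)) * f (p y)"
    have sub: "{b. f b \<noteq> 0} \<subseteq> A"
      by (auto simp: A_def)
    have "nf = l2_norm (verts G1) ?h"
      unfolding nf_def by (rule l2_norm_lift(2)[OF \<omega> f sub])
    also have "\<dots> \<le> C * l2_norm (verts G1) (mat_op (laplace_matrix G1 \<alpha>1 c) ?h)"
      using C(2) l2_norm_lift(1)[OF \<omega> f sub] unfolding bounded_below_def by blast
    also have "\<dots> \<le> C * (l2_norm (verts G2) (mat_op (laplace_matrix G2 \<alpha>2 c) f) + 2 * \<eta> * M * (real D + 1) * nf)"
    proof (rule mult_left_mono)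
      show "l2_norm (verts G1) (mat_op (laplace_matrix G1 \<alpha>1 c) ?h)
          \<le> l2_norm (verts G2) (mat_op (laplace_matrix G2 \<alpha>2 c) f) + 2 * \<eta> * M * (real D + 1) * nf"
        unfolding nf_def
      proof (rule laplace_matrix_lift[where A = A])
        show "b \<in> A" if "f b \<noteq> 0" for b
          using that sub by blast
      qed (fact \<alpha> deg M f A_nbr \<omega> \<eta>(1))+
    qed (use C(1) in simp)
    also have "\<dots> = C * l2_norm (verts G2) (mat_op (laplace_matrix G2 \<alpha>2 c) f) + \<eta> * L"
      by (simp add: L_def algebra_simps)
    finally show "nf \<le> C * l2_norm (verts G2) (mat_op (laplace_matrix G2 \<alpha>2 c) f) + \<epsilon>"
      using \<eta>(2) by linarith
  qed
qed

end


section \<open>Balls in the path metric\<close>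

lemma path_dist_le_iff: "path_dist G u w \<le> enat n \<longleftrightarrow> (\<exists>k\<le>n. (u, w) \<in> adj G ^^ k)"
proof
  define S where "S = enat ` {k. (u, w) \<in> adj G ^^ k}"
  assume le: "path_dist G u w \<le> enat n"
  have "S \<noteq> {}"
  proof
    assume "S = {}"
    then have "path_dist G u w = \<infinity>"
      by (simp add: path_dist_def S_def top_enat_def)
    then show False
      using le by simp
  qed
  then have "Inf S \<in> S"
    unfolding Inf_enat_def by (auto intro: LeastI)
  then show "\<exists>k\<le>n. (u, w) \<in> adj G ^^ k"
    using le by (auto simp: path_dist_def S_def)
next
  assume "\<exists>k\<le>n. (u, w) \<in> adj G ^^ k"
  then obtain k where k: "k \<le> n" "(u, w) \<in> adj G ^^ k" by blast
  then have "path_dist G u w \<le> enat k"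
    unfolding path_dist_def by (intro INF_lower) simp
  then show "path_dist G u w \<le> enat n"
    using k(1) by (meson enat_ord_simps(1) order_trans)
qed

lemma vball_eq: "vball G n v = {w \<in> verts G. \<exists>k\<le>n. (v, w) \<in> adj G ^^ k}"
  by (simp add: vball_def path_dist_le_iff)

lemma adj_iff:
  assumes "is_mgraph G"
  shows "(u, w) \<in> adj G \<longleftrightarrow> (\<exists>e\<in>edges_at G u. other_end G u e = w)"
proof -
  have "e \<in> edges_at G u \<and> other_end G u e = w \<longleftrightarrow> e \<in> edges G \<and> ends G e = {u, w}" for e
    using edges_at_other_end_eq[OF assms, of u w] by blast
  then show ?thesis
    unfolding adj_def by blast
qed

lemma finite_vball:
  assumes "is_mgraph G"
  shows "finite (vball G n v)"
proof -
  have "finite {w. (v, w) \<in> adj G ^^ k}" for k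
  proof (induction k)
    case (Suc k)
    have "{w. (v, w) \<in> adj G ^^ Suc k} \<subseteq> (\<Union>u\<in>{w. (v, w) \<in> adj G ^^ k}. other_end G u ` edges_at G u)"
      using adj_iff[OF assms] by fastforce
    then show ?case
      by (rule finite_subset) (use Suc finite_edges_at[OF assms] in auto)
  qed simp
  then have "finite (\<Union>k\<le>n. {w. (v, w) \<in> adj G ^^ k})"
    by blast
  moreover have "vball G n v \<subseteq> (\<Union>k\<le>n. {w. (v, w) \<in> adj G ^^ k})"
    by (auto simp: vball_eq)
  ultimately show ?thesis
    by (rule finite_subset[rotated])
qed

context graph_covering
begin

section \<open>Cut-offs from subexponential growth\<close>

text \<open>Only a lower limit is assumed, so \<open>exp (- \<epsilon> d)\<close> need not be square-summable, and it is cut off at a radius \<open>n\<close>.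
  Inside the ball an edge changes \<open>\<omega>\<close> by a factor within \<open>1 \<plusminus> \<eta> / 2\<close>. The edges that leave the ball contribute at most
  \<open>sqrt (2 |B|) exp (- \<epsilon> n)\<close>, where \<open>B\<close> is the ball; this tends to \<open>0\<close> along radii with \<open>|B| \<le> exp (\<epsilon> n)\<close>. The fibre norms over the finite
  set \<open>A\<close> stay above some \<open>\<kappa> > 0\<close> once the ball contains a point over each \<open>b \<in> A\<close>.\<close>

lemma almost_invariant_subexponential:
  assumes conn: "connected_mgraph G1" and growth: "subexponential_growth G1"
    and A: "finite A" "A \<subseteq> verts G2" and \<eta>: "0 < \<eta>"
  shows "\<exists>\<omega>. almost_invariant A \<eta> \<omega>"
proof -
  obtain v where v: "v \<in> verts G1" and lim: "liminf (\<lambda>n. ereal (root n (real (card (vball G1 n v))))) = 1"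
    using growth by (auto simp: subexponential_growth_def)
  define d where "d y = (LEAST k. (v, y) \<in> adj G1 ^^ k)" for y
  have d_path: "(v, y) \<in> adj G1 ^^ d y" if "y \<in> verts G1" for y
  proof -
    have "(v, y) \<in> (adj G1)\<^sup>*"
      using conn v that by (auto simp: connected_mgraph_def)
    then obtain k where "(v, y) \<in> adj G1 ^^ k"
      by (meson rtrancl_power)
    then show ?thesis
      unfolding d_def by (rule LeastI)
  qed
  have d_step: "d y' \<le> Suc (d y)" if "y \<in> verts G1" "(y, y') \<in> adj G1" for y y'
    unfolding d_def[of y'] by (rule Least_le) (use d_path[OF that(1)] that(2) in auto)
  have ball: "vball G1 n v = {y \<in> verts G1. d y \<le> n}" for n
    using d_path unfolding vball_eq d_def by (auto intro: Least_le order_trans)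

  \<comment> \<open>so that \<open>exp \<epsilon> - 1\<close>, which bounds the relative change of \<open>\<omega>\<close> along an edge inside the ball, is \<open>\<eta> / 2\<close>\<close>
  define \<epsilon> where "\<epsilon> = ln (1 + \<eta> / 2)"
  have \<epsilon>: "0 < \<epsilon>" "exp \<epsilon> = 1 + \<eta> / 2"
    using \<eta> by (auto simp: \<epsilon>_def)
  define y where "y b = (SOME y. y \<in> fibre b)" for b
  have y: "y b \<in> fibre b" if "b \<in> A" for b
  proof -
    have "\<exists>y. y \<in> fibre b"
      using fibre_nonempty[of b] A(2) that by (auto simp: fibre_def)
    then show ?thesis
      unfolding y_def by (rule someI_ex)
  qed
  \<comment> \<open>a convenient upper bound for the finitely many distances \<open>d (y b)\<close>\<close>
  define m where "m = (\<Sum>b\<in>A. d (y b))"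
  have m: "d (y b) \<le> m" if "b \<in> A" for b
    unfolding m_def using A(1) that by (intro member_le_sum) auto
  define \<kappa> where "\<kappa> = exp (- \<epsilon> * real m)"
  have "0 < \<kappa>" by (simp add: \<kappa>_def)

  obtain n where n: "m \<le> n" "sqrt (2 * real (card (vball G1 n v))) * exp (- \<epsilon> * real n) \<le> \<eta> / 2 * \<kappa>"
  proof -
    have "\<exists>\<^sub>F n in sequentially. root n (real (card (vball G1 n v))) < exp \<epsilon>"
    proof (rule ccontr)
      assume "\<not> ?thesis"
      then have "\<forall>\<^sub>F n in sequentially. ereal (exp \<epsilon>) \<le> ereal (root n (real (card (vball G1 n v))))"
        by (simp add: not_frequently not_less)
      then have "ereal (exp \<epsilon>) \<le> 1"
        unfolding lim[symmetric] by (rule Liminf_bounded)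
      then show False
        using \<epsilon>(1) by simp
    qed
    moreover have "\<forall>\<^sub>F n in sequentially. sqrt 2 * exp (- (\<epsilon> / 2) * real n) < \<eta> / 2 * \<kappa>"
    proof -
      have "filterlim (\<lambda>n. - (\<epsilon> / 2) * real n) at_bot sequentially"
        using \<epsilon>(1) by (intro filterlim_tendsto_neg_mult_at_bot[OF tendsto_const _ filterlim_real_sequentially]) simp
      then have "(\<lambda>n. exp (- (\<epsilon> / 2) * real n)) \<longlonglongrightarrow> 0"
        by (rule filterlim_compose[OF exp_at_bot])
      then have "(\<lambda>n. sqrt 2 * exp (- (\<epsilon> / 2) * real n)) \<longlonglongrightarrow> 0"
        by (rule tendsto_mult_right_zero)
      then show ?thesis
        by (rule order_tendstoD(2)) (use \<eta> \<open>0 < \<kappa>\<close> in simp)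
    qed
    moreover have "\<forall>\<^sub>F n in sequentially. max m 1 \<le> n"
      by (rule eventually_ge_at_top)
    ultimately have "\<exists>\<^sub>F n in sequentially. root n (real (card (vball G1 n v))) < exp \<epsilon> \<and>
        sqrt 2 * exp (- (\<epsilon> / 2) * real n) < \<eta> / 2 * \<kappa> \<and> max m 1 \<le> n"
      by (intro frequently_eventually_frequently eventually_conj)
    then obtain n where n: "root n (real (card (vball G1 n v))) < exp \<epsilon>"
      "sqrt 2 * exp (- (\<epsilon> / 2) * real n) < \<eta> / 2 * \<kappa>" "m \<le> n" "1 \<le> n"
      by (auto dest: frequently_ex)
    define B where "B = real (card (vball G1 n v))"
    have "B = root n B ^ n"
      using n(4) by (simp add: B_def)
    also have "\<dots> \<le> exp \<epsilon> ^ n"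
      using n(1) by (intro power_mono) (auto simp: B_def real_root_ge_zero)
    also have "\<dots> = (exp (\<epsilon> / 2 * real n))\<^sup>2"
      by (simp add: exp_of_nat_mult[symmetric] mult_ac flip: exp_double)
    finally have "sqrt B \<le> exp (\<epsilon> / 2 * real n)"
      by (simp add: real_le_lsqrt)
    then have "sqrt (2 * B) * exp (- \<epsilon> * real n) \<le> (sqrt 2 * exp (\<epsilon> / 2 * real n)) * exp (- \<epsilon> * real n)"
      by (simp add: real_sqrt_mult)
    also have "\<dots> = sqrt 2 * exp (- (\<epsilon> / 2) * real n)"
      by (simp add: exp_add[symmetric] mult.assoc)
    finally show thesis
      using that[of n] n by (simp add: B_def)
  qed

  define B where "B = vball G1 n v"
  have B: "finite B" "B \<subseteq> verts G1"
    unfolding B_def by (rule finite_vball[OF G1]) (simp add: vball_eq)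
  define \<omega> where "\<omega> z = (if z \<in> B then exp (- \<epsilon> * real (d z)) else 0)" for z
  have supp: "{z. \<omega> z \<noteq> 0} = B"
    by (auto simp: \<omega>_def)
  have "almost_invariant A \<eta> \<omega>"
    unfolding almost_invariant_def supp
  proof (intro conjI ballI allI impI B)
    fix b assume b: "b \<in> A"
    have N: "\<kappa> \<le> fibre_norm \<omega> b"
    proof -
      have yb: "y b \<in> B"
        using y[OF b] m[OF b] n(1) by (simp add: B_def ball fibre_def)
      have "\<kappa> \<le> exp (- \<epsilon> * real (d (y b)))"
        using m[OF b] \<epsilon>(1) by (simp add: \<kappa>_def)
      also have "\<dots> = L2_set \<omega> {y b}"
        using yb by (simp add: \<omega>_def)
      also have "\<dots> \<le> fibre_norm \<omega> b"
        by (rule L2_set_subset_fibre(1)) (use y[OF b] supp B in auto)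
      finally show ?thesis .
    qed
    then show "0 < fibre_norm \<omega> b"
      using \<open>0 < \<kappa>\<close> by linarith
    fix e Y assume e: "e \<in> edges_at G2 b" and Y: "finite Y \<and> Y \<subseteq> fibre b"
    define R where "R = {z \<in> Y. z \<in> B \<or> transport e z \<in> B}"
    \<comment> \<open>across the boundary of the ball the inner end has \<open>d = n\<close>, and \<open>\<omega>\<close> jumps by \<open>exp (- \<epsilon> n)\<close>\<close>
    define r where "r z = (if z \<in> R then exp (- \<epsilon> * real n) else 0)" for z
    have diff: "\<bar>\<omega> (transport e z) - \<omega> z\<bar> \<le> \<eta> / 2 * \<omega> z + r z" if z: "z \<in> Y" for z
    proof -
      let ?z = "transport e z"
      have zV: "z \<in> verts G1" "e \<in> edges_at G2 (p z)"
        using z Y e by (auto simp: fibre_def)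
      note t = transport[OF zV]
      have d1: "d ?z \<le> Suc (d z)"
        by (rule d_step[OF zV(1) t(4)])
      have d2: "d z \<le> Suc (d ?z)"
        using d_step[OF t(1)] transport(4)[OF t(1) t(5)] t(3) by simp
      consider "z \<in> B" "?z \<in> B" | "z \<in> B" "?z \<notin> B" | "z \<notin> B" "?z \<in> B" | "z \<notin> B" "?z \<notin> B"
        by blast
      then show ?thesis
      proof cases
        case 1
        have "exp (- \<epsilon> * real (d ?z)) \<le> exp \<epsilon> * exp (- \<epsilon> * real (d z))"
        proof -
          have "\<epsilon> * real (d z) \<le> \<epsilon> * (1 + real (d ?z))"
            using d2 \<epsilon>(1) by (intro mult_left_mono) auto
          then show ?thesis
            by (simp add: exp_add[symmetric] algebra_simps)
        qed
        moreover have "(2 - exp \<epsilon>) * exp (- \<epsilon> * real (d z)) \<le> exp (- \<epsilon> * real (d ?z))"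
        proof -
          have "2 - exp \<epsilon> \<le> exp (- \<epsilon>)"
            using exp_ge_add_one_self[of "- \<epsilon>"] exp_ge_add_one_self[of \<epsilon>] by linarith
          then have "(2 - exp \<epsilon>) * exp (- \<epsilon> * real (d z)) \<le> exp (- \<epsilon>) * exp (- \<epsilon> * real (d z))"
            by (intro mult_right_mono) auto
          also have "\<dots> \<le> exp (- \<epsilon> * real (d ?z))"
          proof -
            have "\<epsilon> * real (d ?z) \<le> \<epsilon> * (1 + real (d z))"
              using d1 \<epsilon>(1) by (intro mult_left_mono) auto
            then show ?thesis
              by (simp add: exp_add[symmetric] algebra_simps)
          qed
          finally show ?thesis .
        qed
        moreover have "0 \<le> r z" by (simp add: r_def)
        ultimately show ?thesis
          using 1 unfolding \<omega>_def \<epsilon>(2) by (simp add: abs_le_iff algebra_simps)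
      next
        case 2
        then have "d z = n"
          using d1 zV(1) t(1) by (auto simp: B_def ball)
        then show ?thesis
          using 2 z \<eta> by (simp add: \<omega>_def r_def R_def)
      next
        case 3
        then have "d ?z = n"
          using d2 zV(1) t(1) by (auto simp: B_def ball)
        then show ?thesis
          using 3 z by (simp add: \<omega>_def r_def R_def)
      next
        case 4
        then show ?thesis by (simp add: \<omega>_def r_def)
      qed
    qed
    have "L2_set (\<lambda>z. \<omega> (transport e z) - \<omega> z) Y \<le> L2_set (\<lambda>z. \<eta> / 2 * \<omega> z + r z) Y"
    proof -
      have "L2_set (\<lambda>z. \<omega> (transport e z) - \<omega> z) Y = L2_set (\<lambda>z. \<bar>\<omega> (transport e z) - \<omega> z\<bar>) Y"
        by (simp add: L2_set_def)
      also have "\<dots> \<le> L2_set (\<lambda>z. \<eta> / 2 * \<omega> z + r z) Y"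
        by (intro L2_set_mono diff) auto
      finally show ?thesis .
    qed
    also have "\<dots> \<le> L2_set (\<lambda>z. \<eta> / 2 * \<omega> z) Y + L2_set r Y"
      by (rule L2_set_triangle_ineq)
    also have "L2_set (\<lambda>z. \<eta> / 2 * \<omega> z) Y \<le> \<eta> / 2 * fibre_norm \<omega> b"
    proof -
      have "L2_set (\<lambda>z. \<eta> / 2 * \<omega> z) Y = \<eta> / 2 * L2_set \<omega> Y"
        using \<eta> by (intro L2_set_right_distrib[symmetric]) simp
      also have "\<dots> \<le> \<eta> / 2 * fibre_norm \<omega> b"
        using \<eta> Y supp B by (intro mult_left_mono L2_set_subset_fibre(1)) auto
      finally show ?thesis .
    qed
    also have "L2_set r Y \<le> \<eta> / 2 * fibre_norm \<omega> b"
    proof -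
      have "card R \<le> card {z \<in> Y. z \<in> B} + card {z \<in> Y. transport e z \<in> B}"
        unfolding R_def by (rule order_trans[OF card_mono card_Un_le]) (use Y in auto)
      also have "\<dots> \<le> card B + card B"
      proof (rule add_mono)
        show "card {z \<in> Y. z \<in> B} \<le> card B"
          using B by (intro card_mono) auto
        show "card {z \<in> Y. transport e z \<in> B} \<le> card B"
          using inj_on_transport[OF e, of "{z \<in> Y. transport e z \<in> B}"] Y B
          by (intro card_inj_on_le[of "transport e"]) auto
      qed
      finally have card_R: "real (card R) \<le> 2 * real (card B)"
        by simp
      have "L2_set r Y = sqrt (\<Sum>z\<in>R. (exp (- \<epsilon> * real n))\<^sup>2)"
        unfolding L2_set_def
        by (intro arg_cong[of _ _ sqrt] sum.mono_neutral_cong_right) (use Y in \<open>auto simp: r_def R_def\<close>)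
      also have "\<dots> = sqrt (real (card R)) * exp (- \<epsilon> * real n)"
        by (simp add: real_sqrt_mult)
      also have "\<dots> \<le> sqrt (2 * real (card B)) * exp (- \<epsilon> * real n)"
        using card_R by (intro mult_right_mono) auto
      also have "\<dots> \<le> \<eta> / 2 * \<kappa>"
        using n(2) by (simp add: B_def)
      also have "\<dots> \<le> \<eta> / 2 * fibre_norm \<omega> b"
        using N \<eta> by (intro mult_left_mono) auto
      finally show ?thesis .
    qed
    finally show "L2_set (\<lambda>z. \<omega> (transport e z) - \<omega> z) Y \<le> \<eta> * fibre_norm \<omega> b"
      by (simp add: field_simps)
  qed
  then show ?thesis by blast
qed

section \<open>Cut-offs from Folner sets\<close>

context
  fixes F :: "nat \<Rightarrow> 'v1 set" and \<beta> :: "nat \<Rightarrow> nat"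
  assumes finite_F: "\<And>k. finite (F k)" and F_verts: "\<And>k. F k \<subseteq> verts G1"
  defines "\<beta> \<equiv> \<lambda>k. card (vball_set G1 1 (F k) - F k)"
begin

lemma in_boundary:
  assumes "y \<in> verts G1" "e \<in> edges_at G2 (p y)" "y \<in> F k" "transport e y \<notin> F k"
  shows "transport e y \<in> vball_set G1 1 (F k) - F k"
  using transport[OF assms(1,2)] assms(3,4)
  by (auto simp: vball_set_def vball_eq intro!: bexI[of _ y] exI[of _ "Suc 0"])

lemma finite_boundary: "finite (vball_set G1 1 (F k) - F k)"
  using finite_F finite_vball[OF G1] by (auto simp: vball_set_def)

text \<open>Along a given edge, the points that leave \<open>F k\<close> are mapped injectively into its boundary, and the points that
  enter \<open>F k\<close> start in the boundary. Hence there are at most \<open>\<beta> k\<close> of either kind.\<close>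

lemma card_leaving_le:
  assumes "e \<in> edges_at G2 b" "Y \<subseteq> fibre b"
  shows "card {y \<in> Y. y \<in> F k \<and> transport e y \<notin> F k} \<le> \<beta> k"
  unfolding \<beta>_def
proof (rule card_inj_on_le[OF _ _ finite_boundary])
  show "inj_on (transport e) {y \<in> Y. y \<in> F k \<and> transport e y \<notin> F k}"
    using assms by (intro inj_on_transport[OF assms(1)]) auto
  show "transport e ` {y \<in> Y. y \<in> F k \<and> transport e y \<notin> F k} \<subseteq> vball_set G1 1 (F k) - F k"
    using assms by (intro image_subsetI in_boundary) (auto simp: fibre_def)
qed

lemma card_entering_le:
  assumes "e \<in> edges_at G2 b" "Y \<subseteq> fibre b"
  shows "card {y \<in> Y. y \<notin> F k \<and> transport e y \<in> F k} \<le> \<beta> k"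
  unfolding \<beta>_def
proof (rule card_mono[OF finite_boundary], rule subsetI)
  fix y assume y: "y \<in> {y \<in> Y. y \<notin> F k \<and> transport e y \<in> F k}"
  then have "y \<in> verts G1" "e \<in> edges_at G2 (p y)"
    using assms by (auto simp: fibre_def)
  note t = transport[OF this]
  show "y \<in> vball_set G1 1 (F k) - F k"
    using in_boundary[OF t(1) t(5)] t(3) y by simp
qed

text \<open>Each step of the path costs at most \<open>\<beta> k\<close>; the number \<open>j\<close> of steps is independent of \<open>k\<close>, which
  is what allows passing to the limit later.\<close>

lemma card_fibre_path:
  assumes path: "(y, z) \<in> (adj G1)\<^sup>*" and y: "y \<in> verts G1"
  shows "z \<in> verts G1 \<and> (\<exists>j. \<forall>k. card (F k \<inter> fibre (p y)) \<le> card (F k \<inter> fibre (p z)) + j * \<beta> k)"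
  using path
proof (induction rule: rtrancl_induct)
  case base
  show ?case using y by (auto intro: exI[of _ 0])
next
  case (step z z')
  then obtain j where z: "z \<in> verts G1"
    and j: "\<And>k. card (F k \<inter> fibre (p y)) \<le> card (F k \<inter> fibre (p z)) + j * \<beta> k"
    by blast
  obtain e' where e': "e' \<in> edges_at G1 z" "other_end G1 z e' = z'"
    using step(2) adj_iff[OF G1] by blast
  define e where "e = q e'"
  have e: "e \<in> edges_at G2 (p z)"
    using q_bij[OF z] e' by (auto simp: e_def bij_betw_def)
  have z': "transport e z = z'"
    using lift_edge_q[OF z e'(1)] e'(2) by (simp add: transport_def e_def)
  then have "z' \<in> verts G1" "p z' = other_end G2 (p z) e"
    using transport[OF z e] by auto
  have "card (F k \<inter> fibre (p z)) \<le> card (F k \<inter> fibre (p z')) + \<beta> k" for k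
  proof -
    let ?Y = "F k \<inter> fibre (p z)"
    have "card ?Y \<le> card {y \<in> ?Y. transport e y \<in> F k} + card {y \<in> ?Y. y \<in> F k \<and> transport e y \<notin> F k}"
      by (rule order_trans[OF card_mono card_Un_le]) (use finite_F in auto)
    moreover have "card {y \<in> ?Y. transport e y \<in> F k} \<le> card (F k \<inter> fibre (p z'))"
    proof (rule card_inj_on_le)
      show "inj_on (transport e) {y \<in> ?Y. transport e y \<in> F k}"
        by (rule inj_on_transport[OF e]) auto
      show "transport e ` {y \<in> ?Y. transport e y \<in> F k} \<subseteq> F k \<inter> fibre (p z')"
        using transport_fibre(1)[OF e] \<open>p z' = other_end G2 (p z) e\<close> by auto
    qed (use finite_F in auto)
    moreover have "card {y \<in> ?Y. y \<in> F k \<and> transport e y \<notin> F k} \<le> \<beta> k"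
      by (rule card_leaving_le[OF e]) auto
    ultimately show ?thesis by linarith
  qed
  then have "card (F k \<inter> fibre (p y)) \<le> card (F k \<inter> fibre (p z')) + \<beta> k + j * \<beta> k" for k
    using j[of k] by (meson add_right_mono order_trans)
  then have "card (F k \<inter> fibre (p y)) \<le> card (F k \<inter> fibre (p z')) + Suc j * \<beta> k" for k
    by (simp add: add.assoc)
  then show ?case
    using \<open>z' \<in> verts G1\<close> by blast
qed

lemma almost_invariant_indicator:
  assumes "\<And>b. b \<in> A \<Longrightarrow> 0 < card (F k \<inter> fibre b)"
    and "\<And>b. b \<in> A \<Longrightarrow> 2 * real (\<beta> k) \<le> \<eta>\<^sup>2 * real (card (F k \<inter> fibre b))" and "0 < \<eta>"
  shows "almost_invariant A \<eta> (indicator (F k))"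
  unfolding almost_invariant_def
proof (intro conjI ballI allI impI)
  show "finite {y. indicator (F k) y \<noteq> (0::real)}" "{y. indicator (F k) y \<noteq> (0::real)} \<subseteq> verts G1"
    using finite_F[of k] F_verts[of k] by (auto simp: indicator_def)
  fix b assume b: "b \<in> A"
  have "{y \<in> fibre b. indicator (F k) y \<noteq> (0::real)} = F k \<inter> fibre b"
    by (auto simp: indicator_def)
  then have N: "fibre_norm (indicator (F k)) b = sqrt (real (card (F k \<inter> fibre b)))"
    by (simp add: fibre_norm_def L2_set_def indicator_def)
  then show "0 < fibre_norm (indicator (F k)) b"
    using assms(1)[OF b] by simp
  fix e Y assume e: "e \<in> edges_at G2 b" and Y: "finite Y \<and> Y \<subseteq> fibre b"
  define R where "R = {y \<in> Y. y \<in> F k \<and> transport e y \<notin> F k} \<union> {y \<in> Y. y \<notin> F k \<and> transport e y \<in> F k}"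
  have "(\<Sum>y\<in>Y. (indicator (F k) (transport e y) - indicator (F k) y)\<^sup>2) = (\<Sum>y\<in>R. (1::real))"
    by (rule sum.mono_neutral_cong_right) (use Y in \<open>auto simp: R_def indicator_def\<close>)
  also have "\<dots> = real (card R)"
    by simp
  also have "\<dots> \<le> real (\<beta> k + \<beta> k)"
    unfolding R_def using card_leaving_le[OF e, of Y k] card_entering_le[OF e, of Y k] Y
    by (intro of_nat_mono order_trans[OF card_Un_le add_mono]) auto
  also have "\<dots> \<le> \<eta>\<^sup>2 * real (card (F k \<inter> fibre b))"
    using assms(2)[OF b] by simp
  finally have "L2_set (\<lambda>y. indicator (F k) (transport e y) - indicator (F k) y) Y
      \<le> sqrt (\<eta>\<^sup>2 * real (card (F k \<inter> fibre b)))"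
    unfolding L2_set_def by (rule real_sqrt_le_mono)
  then show "L2_set (\<lambda>y. indicator (F k) (transport e y) - indicator (F k) y) Y \<le> \<eta> * fibre_norm (indicator (F k)) b"
    using assms(3) by (simp add: N real_sqrt_mult)
qed

end

text \<open>As \<open>\<Gamma>2\<close> is finite and connected, one constant \<open>J\<close> serves for all pairs of fibres:
  any two fibres meet \<open>F k\<close> in numbers differing by at most \<open>J * \<beta> k\<close>. Adding up, each fibre contains about
  \<open>1 / N\<close> of the points of \<open>F k\<close>, where \<open>N\<close> is the number of vertices of \<open>\<Gamma>2\<close>.\<close>

lemma almost_invariant_amenable:
  assumes conn: "connected_mgraph G1" and am: "amenable G1" and fin: "finite (verts G2)"
    and \<eta>: "0 < \<eta>" and A: "A \<subseteq> verts G2"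
  shows "\<exists>\<omega>. almost_invariant A \<eta> \<omega>"
proof (cases "verts G2 = {}")
  case True
  then show ?thesis
    using A by (intro exI[of _ "\<lambda>_. 0"]) (auto simp: almost_invariant_def)
next
  case False
  obtain F where inc: "incseq F" and F: "\<And>k. finite (F k)" "(\<Union>k. F k) = verts G1"
    and lim: "(\<lambda>k. real (card (vball_set G1 1 (F k) - F k)) / real (card (F k))) \<longlonglongrightarrow> 0"
    using am unfolding amenable_def by blast
  have F_sub: "F k \<subseteq> verts G1" for k
    using F(2) by blast
  define \<beta> where "\<beta> k = card (vball_set G1 1 (F k) - F k)" for k
  define m where "m b k = card (F k \<inter> fibre b)" for b k
  have ex_j: "\<exists>j. \<forall>k. m b' k \<le> m b k + j * \<beta> k" if b: "b \<in> verts G2" and b': "b' \<in> verts G2" for b b'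
  proof -
    obtain y where y: "y \<in> verts G1" "p y = b'"
      using fibre_nonempty[OF b'] .
    obtain z where z: "z \<in> verts G1" "p z = b"
      using fibre_nonempty[OF b] .
    have "(y, z) \<in> (adj G1)\<^sup>*"
      using conn y z by (simp add: connected_mgraph_def)
    then show ?thesis
      using card_fibre_path[OF F(1) F_sub, of y z] y z by (auto simp: m_def \<beta>_def)
  qed
  then obtain j where j: "\<And>b b' k. b \<in> verts G2 \<Longrightarrow> b' \<in> verts G2 \<Longrightarrow> m b' k \<le> m b k + j b b' * \<beta> k"
    by metis
  define J where "J = (\<Sum>b\<in>verts G2. \<Sum>b'\<in>verts G2. j b b')"
  have jJ: "j b b' \<le> J" if "b \<in> verts G2" "b' \<in> verts G2" for b b'
  proof -
    have "j b b' \<le> (\<Sum>b'\<in>verts G2. j b b')"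
      using fin that by (intro member_le_sum) auto
    also have "\<dots> \<le> J"
      unfolding J_def using fin that by (intro member_le_sum[of b _ "\<lambda>b. \<Sum>b'\<in>verts G2. j b b'"]) auto
    finally show ?thesis .
  qed
  define N where "N = real (card (verts G2))"
  have "0 < N"
    using False fin by (simp add: N_def card_gt_0_iff)
  have total: "real (card (F k)) \<le> N * (real (m b k) + real J * real (\<beta> k))" if b: "b \<in> verts G2" for b k
  proof -
    have "(\<Sum>b'\<in>verts G2. \<Sum>y | y \<in> F k \<and> p y = b'. 1 :: nat) = (\<Sum>y\<in>F k. 1)"
      using F_sub[of k] p_in by (intro sum.group F(1) fin) blast
    then have "card (F k) = (\<Sum>b'\<in>verts G2. card {y \<in> F k. p y = b'})"
      by simp
    also have "\<dots> = (\<Sum>b'\<in>verts G2. m b' k)"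
    proof (rule sum.cong[OF refl])
      fix b'
      have "{y \<in> F k. p y = b'} = F k \<inter> fibre b'"
        using F_sub[of k] by (auto simp: fibre_def)
      then show "card {y \<in> F k. p y = b'} = m b' k"
        by (simp add: m_def)
    qed
    also have "\<dots> \<le> (\<Sum>b'\<in>verts G2. m b k + J * \<beta> k)"
      using j[OF b] jJ[OF b] by (intro sum_mono) (meson add_left_mono mult_right_mono order_trans le0)
    finally have "real (card (F k)) \<le> real (card (verts G2) * (m b k + J * \<beta> k))"
      by (simp only: of_nat_le_iff sum_constant of_nat_id)
    then show ?thesis
      by (simp add: N_def)
  qed
  \<comment> \<open>the first bound keeps at least half of the average \<open>card (F k) / N\<close> in each fibre,
    the second makes the boundary small relative to that half\<close>
  define \<delta> where "\<delta> = min (1 / (2 * N * (real J + 1))) (\<eta>\<^sup>2 / (4 * N))"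
  have "0 < \<delta>"
    using \<open>0 < N\<close> \<eta> by (simp add: \<delta>_def)
  obtain y0 where "y0 \<in> verts G1"
    using False fibre_nonempty by blast
  then obtain k0 where k0: "y0 \<in> F k0"
    using F(2) by blast
  have "\<forall>\<^sub>F k in sequentially. real (\<beta> k) / real (card (F k)) < \<delta>"
    using order_tendstoD(2)[OF lim \<open>0 < \<delta>\<close>] by (simp add: \<beta>_def)
  then have "\<forall>\<^sub>F k in sequentially. real (\<beta> k) / real (card (F k)) < \<delta> \<and> k0 \<le> k"
    by (intro eventually_conj eventually_ge_at_top)
  then obtain k where k: "real (\<beta> k) / real (card (F k)) < \<delta>" "k0 \<le> k"
    using eventually_happens'[OF sequentially_bot] by fastforce
  define f where "f = real (card (F k))"
  have "F k \<noteq> {}"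
    using k0 incseqD[OF inc k(2)] by blast
  then have "0 < f"
    using F(1) by (simp add: f_def card_gt_0_iff)
  have \<beta>: "real (\<beta> k) \<le> \<delta> * f"
    using k(1) \<open>0 < f\<close> by (simp add: f_def field_simps)
  have m_lower: "f / (2 * N) \<le> real (m b k)" if "b \<in> verts G2" for b
  proof -
    have "real J * real (\<beta> k) \<le> (real J + 1) * (f / (2 * N * (real J + 1)))"
    proof (rule mult_mono)
      have "\<delta> * f \<le> 1 / (2 * N * (real J + 1)) * f"
        using \<open>0 < f\<close> by (intro mult_right_mono) (auto simp: \<delta>_def)
      then show "real (\<beta> k) \<le> f / (2 * N * (real J + 1))"
        using \<beta> by simp
    qed auto
    also have "\<dots> = f / (2 * N)"
    proof -
      have "x * (f / (2 * N * x)) = f / (2 * N)" if "0 < x" for x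
        using that by simp
      then show ?thesis by simp
    qed
    finally have "f \<le> N * (real (m b k) + f / (2 * N))"
      using total[OF that, of k] \<open>0 < N\<close> unfolding f_def[symmetric]
      by (meson add_left_mono mult_left_mono order_trans less_imp_le)
    then show ?thesis
      using \<open>0 < N\<close> by (simp add: field_simps)
  qed
  have "almost_invariant A \<eta> (indicator (F k))"
  proof (rule almost_invariant_indicator[OF F(1) F_sub _ _ \<eta>])
    fix b assume "b \<in> A"
    then have b: "f / (2 * N) \<le> real (m b k)"
      using A m_lower by blast
    then show "0 < card (F k \<inter> fibre b)"
      using \<open>0 < f\<close> \<open>0 < N\<close> divide_pos_pos[of f "2 * N"] unfolding m_def by linarith
    have "\<delta> * f \<le> \<eta>\<^sup>2 / (4 * N) * f"
      using \<open>0 < f\<close> by (intro mult_right_mono) (auto simp: \<delta>_def)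
    then have "2 * real (\<beta> k) \<le> 2 * (\<eta>\<^sup>2 / (4 * N) * f)"
      using \<beta> by linarith
    also have "\<dots> = \<eta>\<^sup>2 * (f / (2 * N))"
      by simp
    also have "\<dots> \<le> \<eta>\<^sup>2 * real (m b k)"
      using b by (intro mult_left_mono) auto
    finally show "2 * real (card (vball_set G1 1 (F k) - F k)) \<le> \<eta>\<^sup>2 * real (card (F k \<inter> fibre b))"
      by (simp add: \<beta>_def m_def)
  qed
  then show ?thesis by blast
qed

end

section \<open>Inclusion of the spectra\<close>

lemma shifted_laplace_eq_mat_op:
  assumes "is_mgraph G" "f \<in> l2 (verts G)"
  shows "(\<lambda>v. laplace G f v - c * f v) = mat_op (laplace_matrix G (weight G) c) f"
proof
  fix v
  show "laplace G f v - c * f v = mat_op (laplace_matrix G (weight G) c) f v"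
  proof (cases "v \<in> verts G")
    case True
    then show ?thesis
      using mat_op_laplace_matrix[OF assms(1)] by (simp add: laplace_def)
  next
    case False
    then have "{w. laplace_matrix G (weight G) c v w \<noteq> 0} = {}"
      using laplace_matrix_entries[OF assms(1)] by blast
    then have "mat_op (laplace_matrix G (weight G) c) f v = 0"
      by (simp only: mat_op_def sum.empty)
    then show ?thesis
      using False assms(2) by (simp add: laplace_def l2_zero_outside)
  qed
qed

theorem theorem1p6:
  fixes G1 :: "('v1, 'e1) wgraph" and G2 :: "('v2, 'e2) wgraph"
  assumes "is_mgraph G1" and "uniformly_bounded G1" and "connected_mgraph G1"
    and "is_mgraph G2"
    and "weighted_covers G1 G2"
    and "(amenable G1 \<and> finite_mgraph G2) \<or> subexponential_growth G1"
  shows "l2_spectrum (verts G2) (laplace G2) \<subseteq> l2_spectrum (verts G1) (laplace G1)"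
proof -
  obtain p q where cov: "covering G1 G2 p q"
    and \<alpha>: "\<And>v e. v \<in> verts G1 \<Longrightarrow> e \<in> edges_at G1 v \<Longrightarrow> weight G1 v e = weight G2 (p v) (q e)"
    using assms(5) unfolding weighted_covers_def by blast
  interpret graph_covering G1 G2 p q
    by unfold_locales (fact assms cov)+
  have inv: "\<exists>\<omega>. almost_invariant A \<eta> \<omega>" if "finite A" "A \<subseteq> verts G2" "0 < \<eta>" for A \<eta>
    using assms(3,6) that almost_invariant_amenable almost_invariant_subexponential
    unfolding finite_mgraph_def by blast
  obtain D1 where deg1: "\<And>v. v \<in> verts G1 \<Longrightarrow> card (edges_at G1 v) \<le> D1"
    using assms(1) by (auto simp: is_mgraph_def bounded_degree_def)
  obtain D2 where deg2: "\<And>v. v \<in> verts G2 \<Longrightarrow> card (edges_at G2 v) \<le> D2"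
    using assms(4) by (auto simp: is_mgraph_def bounded_degree_def)
  obtain M where M: "0 \<le> M" and M1: "\<And>v e. e \<in> edges_at G1 v \<Longrightarrow> cmod (weight G1 v e) \<le> M"
  proof -
    obtain M where "\<And>v e. v \<in> verts G1 \<Longrightarrow> e \<in> edges_at G1 v \<Longrightarrow> cmod (weight G1 v e) \<le> M"
      using assms(2) unfolding uniformly_bounded_def bounded_iff by blast
    then show thesis
      using that[of "max 0 M"] edge_endpoints(1)[OF G1] by (meson max.cobounded1 max.coboundedI2)
  qed
  have M2: "cmod (weight G2 b e) \<le> M" if e: "e \<in> edges_at G2 b" for b e
  proof -
    obtain y where y: "y \<in> verts G1" "p y = b"
      using fibre_nonempty[OF edge_endpoints(1)[OF G2 e]] .
    then show ?thesis
      using lift_edge[of y e] e \<alpha>[OF y(1)] M1 by metis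
  qed
  have adj_\<alpha>: "adjoint_weight G1 (weight G1) y e = adjoint_weight G2 (weight G2) (p y) (q e)"
    if "y \<in> verts G1" "e \<in> edges_at G1 y" for y e
    using \<alpha>[OF edge_endpoints(2,4)[OF G1 that(2)]] cov that
    by (simp add: adjoint_weight_def covering_def)
  have adj_M2: "cmod (adjoint_weight G2 (weight G2) b e) \<le> M" if "e \<in> edges_at G2 b" for b e
    using M2 edge_endpoints(4)[OF G2 that] by (simp add: adjoint_weight_def)
  have "l2_invertible (verts G2) (\<lambda>f v. laplace G2 f v - c * f v)"
    if inv1: "l2_invertible (verts G1) (\<lambda>f v. laplace G1 f v - c * f v)" for c
  proof -
    let ?a1 = "laplace_matrix G1 (weight G1) c" and ?a2 = "laplace_matrix G2 (weight G2) c"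
    interpret T1: locally_finite_matrix "verts G1" ?a1 "real D1 * M + cmod c + 1"
      by (rule locally_finite_laplace_matrix[OF G1 deg1 M M1])
    interpret T2: locally_finite_matrix "verts G2" ?a2 "real D2 * M + cmod c + 1"
      by (rule locally_finite_laplace_matrix[OF G2 deg2 M M2])
    obtain C where C: "1 \<le> C" "bounded_below (verts G1) C ?a1" "bounded_below (verts G1) C (conj_transpose ?a1)"
      using T1.invertible_imp_bounded_below[OF inv1 shifted_laplace_eq_mat_op[OF G1]] .
    have "bounded_below (verts G2) C ?a2"
      by (rule bounded_below_covering[OF inv \<alpha> deg2 M M2 C(1,2)])
    moreover have "bounded_below (verts G2) C (conj_transpose ?a2)"
      unfolding conj_transpose_laplace_matrix
      by (rule bounded_below_covering[OF inv adj_\<alpha> deg2 M adj_M2 C(1)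
            C(3)[unfolded conj_transpose_laplace_matrix]])
    ultimately show ?thesis
      using T2.bounded_below_imp_invertible[OF C(1) _ _ shifted_laplace_eq_mat_op[OF G2]] by blast
  qed
  then show ?thesis
    unfolding l2_spectrum_def by blast
qed

end
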